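(* Suppose $\alpha_A\le\alpha_B$ and $X_A^{o}<\bar X_A<1$. Suppose the TIC Agreement is in place and country $A$ has $N$ large producers. In the unique and symmetric Nash equilibrium, $$Q_A^{exp}=\begin{cases}\dfrac{N-\eta_A}{N(\eta_A+1)-\eta_A(\eta_A-1)}, & \text{if } N>\eta_A,\\[8pt] 0, & \text{if } N\le\eta_A,\end{cases}\qquad \pi_A=\delta\bigl(1-\eta_AQ_A^{exp}\bigr)-\alpha_A.$$ In all cases $Q_A^{exp}<Q_A^{dom}$ and the production allocation is not conditionally efficient. Moreover, for $N>\eta_A$, $Q_A^{exp}$ is strictly increasing in $N$ and $\pi_A$ is strictly decreasing in $N$. As $N\to\infty$ the production quantities and the certificate price converge to the perfectly competitive outcome under the TIC Agreement: $$Q_A^{exp}\to\frac{1}{1+\eta_A},\qquad Q_A^{dom}\to\frac{1}{1+\eta_A},\qquad \pi_A\to\frac{\delta}{1+\eta_A}-\alpha_A.$$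
   Context: There are two countries $A,B$; $i,j\in\{A,B\}$ with $j\ne i$. There is a unit mass of products $m\in[0,1]$, each traded on its own independent market. In each country demand for each product is exactly one unit at every price below a valuation $v$, which is large enough to exceed all equilibrium prices. The technological marginal cost of product $m$ in country $i$ is $w_i(m)$, and $w_A(m)-w_B(m)=-\alpha_A+\delta m$, where $\alpha_A,\alpha_B>0$ and $\delta=\alpha_A+\alpha_B$. $X_A^{o}=2\alpha_A/\delta$ is country $A$'s total production under free trade and perfect competition; $\bar X_A$ is country $A$'s production goal. A tradeable import certificate (TIC) scheme in country $i$ with certificate price $\pi_i\ge0$ ($\pi_i=0$ if there is no TIC scheme): each imported unit requires one certificate, each exported unit generates $\eta_i$ certificates, and exporters keep a share $\phi_i\in[0,1]$ of certificate revenues. TIC Agreement: country $A$ implements a TIC scheme with $\eta_A=\frac{2-\bar X_A}{\bar X_A}>1$ and $\phi_A\eta_A=1$; country $B$ may also implement a TIC scheme with $\eta_B\ge1$; no country uses direct tariffs or subsidies. Marginal costs are then $c_i^{dom}(m)=w_i(m)$ for domestic sales and $c_i^{exp}(m)=w_i(m)-\phi_i\eta_i\pi_i+\pi_j$ for exports from $i$ to $j$. Write $Q_i^{dom}$ and $Q_i^{exp}$ for country $i$'s total production for its domestic and export market, $Q_A^{imp}=Q_B^{exp}=1-Q_A^{dom}$, $X_i=Q_i^{dom}+Q_i^{exp}$. Equilibrium in the certificate market of country $A$ requires $\eta_AQ_A^{exp}\ge Q_A^{imp}$ and is binding ($\pi_A\ge0$, $\eta_AQ_A^{exp}=Q_A^{imp}>0$),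 non-binding ($\pi_A=0$, $\eta_AQ_A^{exp}\ge Q_A^{imp}$, $Q_A^{exp}>0$) or pure autarky ($Q_A^{exp}=Q_A^{imp}=0$); analogously for $B$. Oligopoly: country $B$ has perfectly competitive producers, while country $A$ has $N$ large producers $n=1,\dots,N$. For every $m\in[0,1]$ exactly one producer $n_m$ of country $A$ can serve market $m$, and in every segment $[m_1,m_2]$ the mass of markets that each producer can serve is $(m_2-m_1)/N$. If in a market the large producer and the competitive producers of $B$ set the same price, the large producer serves the whole market. In each market a large producer either captures the market at the marginal cost of country $B$'s producers or stays out. A strategy of producer $n$ is described by cutoffs $m_n^{dom},m_n^{exp}$: it captures all domestic markets (in country $A$) it can serve in $[0,m_n^{dom}]$ and all export markets (in country $B$) it can serve in $[0,m_n^{exp}]$; equivalently by quantities $q_n^{dom}=m_n^{dom}/N$, $q_n^{exp}=m_n^{exp}/N$. Totals: $Q_A^{dom}=\sum_nq_n^{dom}$, $Q_A^{exp}=\sum_nq_n^{exp}$. Profit in a captured domestic market is $g_n^{dom}(m)=c_B^{exp}(m)-c_A^{dom}(m)$ and in a captured export market $g_n^{exp}(m)=c_B^{dom}(m)-c_A^{exp}(m)$; a producer's total profit is the integral over the markets it captures. Timing: first, all large producers simultaneously choose export quantities $q_n^{exp}\ge0$, each taking into account how its export quantity affects the certificate price $\pi_A$; second, all other quantities are determined such that every firm maximizes its profits taking the equilibrium certificate price $\pi_A$ as given. A production allocation is conditionally efficient if its total direct cost (the total technological production cost of serving all products in both countries) is the lowest achievable given total productions $(X_A,X_B)$; equivalently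 $Q_i^{dom}=Q_i^{exp}$.
   Formalization: Certificate prices are the lowest compatible with second-stage equilibrium (in pure autarky any π_A ≥ α_B clears, so uniqueness fails); each producer's markets have density 1/N, as no measurable assignment n_m exists for N ≥ 2; unit costs are integrable. *)

theory Defs
  imports "HOL-Analysis.Analysis"
begin

datatype country = CA | CB

fun other :: "country \<Rightarrow> country" where
  "other CA = CB"
| "other CB = CA"

text \<open>A technology \<open>w\<close> gives the marginal cost \<open>w i m\<close> of product \<open>m \<in> [0,1]\<close> in
  country \<open>i\<close>. Integrability of each \<open>w i\<close> makes total technological cost well defined.\<close>

definition technology :: "real \<Rightarrow> real \<Rightarrow> (country \<Rightarrow> real \<Rightarrow> real) \<Rightarrow> bool" where
  "technology \<alpha>\<^sub>A \<alpha>\<^sub>B w \<longleftrightarrow>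
     (\<forall>i. set_integrable lborel {0..1} (w i)) \<and>
     (\<forall>m\<in>{0..1}. w CA m - w CB m = - \<alpha>\<^sub>A + (\<alpha>\<^sub>A + \<alpha>\<^sub>B) * m)"


section \<open>Tradeable import certificates\<close>

text \<open>\<open>tic P i\<close>: country \<open>i\<close> runs a TIC scheme, in which an exported unit generates
  \<open>eta P i\<close> certificates and exporters keep the share \<open>phi P i\<close> of certificate revenues.\<close>

record policy =
  tic :: "country \<Rightarrow> bool"
  eta :: "country \<Rightarrow> real"
  phi :: "country \<Rightarrow> real"

definition tic_agreement :: "real \<Rightarrow> policy \<Rightarrow> bool" where
  "tic_agreement Xbar P \<longleftrightarrow>
     tic P CA \<and> eta P CA = (2 - Xbar) / Xbar \<and> eta P CA > 1 \<and>
     0 \<le> phi P CA \<and> phi P CA \<le> 1 \<and> phi P CA * eta P CA = 1 \<and>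
     (tic P CB \<longrightarrow> eta P CB \<ge> 1 \<and> 0 \<le> phi P CB \<and> phi P CB \<le> 1)"

definition cost_dom :: "(country \<Rightarrow> real \<Rightarrow> real) \<Rightarrow> country \<Rightarrow> real \<Rightarrow> real" where
  "cost_dom w i m = w i m"

definition cost_exp ::
  "(country \<Rightarrow> real \<Rightarrow> real) \<Rightarrow> policy \<Rightarrow> (country \<Rightarrow> real) \<Rightarrow> country \<Rightarrow> real \<Rightarrow> real" where
  "cost_exp w P \<pi> i m = w i m - phi P i * eta P i * \<pi> i + \<pi> (other i)"

text \<open>Equilibrium of one country's certificate market, given its certificate price \<open>p\<close>
  and its total exports and imports.\<close>

definition binding :: "real \<Rightarrow> real \<Rightarrow> real \<Rightarrow> real \<Rightarrow> bool" where
  "binding \<eta> p Qexp Qimp \<longleftrightarrow> p \<ge> 0 \<and> \<eta> * Qexp = Qimp \<and> Qimp > 0"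

definition non_binding :: "real \<Rightarrow> real \<Rightarrow> real \<Rightarrow> real \<Rightarrow> bool" where
  "non_binding \<eta> p Qexp Qimp \<longleftrightarrow> p = 0 \<and> \<eta> * Qexp \<ge> Qimp \<and> Qexp > 0"

definition pure_autarky :: "real \<Rightarrow> real \<Rightarrow> bool" where
  "pure_autarky Qexp Qimp \<longleftrightarrow> Qexp = 0 \<and> Qimp = 0"

definition certificate_equilibrium ::
  "policy \<Rightarrow> country \<Rightarrow> real \<Rightarrow> real \<Rightarrow> real \<Rightarrow> bool" where
  "certificate_equilibrium P i p Qexp Qimp \<longleftrightarrow>
     (if tic P i
      then p \<ge> 0 \<and> eta P i * Qexp \<ge> Qimp \<and>
           (binding (eta P i) p Qexp Qimp \<or> non_binding (eta P i) p Qexp Qimp \<or>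
            pure_autarky Qexp Qimp)
      else p = 0)"

text \<open>With \<open>Qd\<close> and \<open>Qe\<close> the domestic and export production of country A, unit demand
  in both countries gives \<open>1 - Qd\<close> for A's imports (B's exports), and \<open>Qe\<close> is B's imports.\<close>

definition certificate_equilibria :: "policy \<Rightarrow> (country \<Rightarrow> real) \<Rightarrow> real \<Rightarrow> real \<Rightarrow> bool" where
  "certificate_equilibria P \<pi> Qd Qe \<longleftrightarrow>
     certificate_equilibrium P CA (\<pi> CA) Qe (1 - Qd) \<and>
     certificate_equilibrium P CB (\<pi> CB) (1 - Qd) Qe"


section \<open>Perfect competition\<close>

text \<open>Every market is served at lowest marginal cost; under the cost assumption of
  \<open>technology\<close>, ties have measure zero.\<close>

definition competitive_equilibrium ::
  "(country \<Rightarrow> real \<Rightarrow> real) \<Rightarrow> policy \<Rightarrow> real \<Rightarrow> real \<Rightarrow> (country \<Rightarrow> real) \<Rightarrow> bool" where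
  "competitive_equilibrium w P Qd Qe \<pi> \<longleftrightarrow>
     Qd = measure lborel {m\<in>{0..1}. cost_dom w CA m \<le> cost_exp w P \<pi> CB m} \<and>
     Qe = measure lborel {m\<in>{0..1}. cost_exp w P \<pi> CA m \<le> cost_dom w CB m} \<and>
     certificate_equilibria P \<pi> Qd Qe"


section \<open>Oligopoly in country A\<close>

text \<open>The large producers of country A are \<open>1, \<dots>, N\<close>. Producer \<open>n\<close> can serve a mass
  \<open>(m2 - m1) / N\<close> of the markets in every segment \<open>[m1, m2]\<close>. For \<open>N \<ge> 2\<close> no Lebesgue
  measurable partition of \<open>[0,1]\<close> has this property, so it is expressed by a density:
  around every \<open>m\<close>, the markets of producer \<open>n\<close> have density \<open>1 / N\<close>.
  Quantities \<open>q\<close> correspond to cutoffs \<open>N * q\<close>.\<close>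

definition profit ::
  "(country \<Rightarrow> real \<Rightarrow> real) \<Rightarrow> policy \<Rightarrow> nat \<Rightarrow> (country \<Rightarrow> real) \<Rightarrow> real \<Rightarrow> real \<Rightarrow> real" where
  "profit w P N \<pi> qd qe =
     (1 / real N) *
       ((LINT m:{0..real N * qd}|lborel. cost_exp w P \<pi> CB m - cost_dom w CA m) +
        (LINT m:{0..real N * qe}|lborel. cost_dom w CB m - cost_exp w P \<pi> CA m))"

text \<open>Strategy profiles are extensional, so that equality of profiles is equality on
  \<open>{1..N}\<close>; cutoffs lie in \<open>[0,1]\<close>.\<close>

definition quantity_profiles :: "nat \<Rightarrow> (nat \<Rightarrow> real) set" where
  "quantity_profiles N = {1..N} \<rightarrow>\<^sub>E {0..1 / real N}"

record outcome =
  qdom :: "nat \<Rightarrow> real"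
  qexp :: "nat \<Rightarrow> real"
  price :: "country \<Rightarrow> real"

definition Qdom :: "nat \<Rightarrow> outcome \<Rightarrow> real" where
  "Qdom N s = (\<Sum>n\<in>{1..N}. qdom s n)"

definition Qexp :: "nat \<Rightarrow> outcome \<Rightarrow> real" where
  "Qexp N s = (\<Sum>n\<in>{1..N}. qexp s n)"

text \<open>Second stage: export quantities \<open>q\<close> are given, domestic quantities maximize profit
  at given certificate prices, and the certificate markets clear. The competitive producers
  of country B serve all remaining markets at their marginal cost.\<close>

definition second_stage_equilibrium ::
  "(country \<Rightarrow> real \<Rightarrow> real) \<Rightarrow> policy \<Rightarrow> nat \<Rightarrow> (nat \<Rightarrow> real) \<Rightarrow> outcome \<Rightarrow> bool" where
  "second_stage_equilibrium w P N q s \<longleftrightarrow>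
     qexp s = q \<and> qdom s \<in> quantity_profiles N \<and>
     (\<forall>n\<in>{1..N}. \<forall>x\<in>{0..1 / real N}.
        profit w P N (price s) x (q n) \<le> profit w P N (price s) (qdom s n) (q n)) \<and>
     certificate_equilibria P (price s) (Qdom N s) (Qexp N s)"

text \<open>Market clearing leaves the certificate prices undetermined in pure autarky: every
  sufficiently high price supports it. The certificate prices are taken to be the lowest
  ones compatible with second-stage equilibrium, which makes them a function of exports.
  Under the TIC Agreement their value at zero exports is also their limit there.\<close>

definition second_stage_outcome ::
  "(country \<Rightarrow> real \<Rightarrow> real) \<Rightarrow> policy \<Rightarrow> nat \<Rightarrow> (nat \<Rightarrow> real) \<Rightarrow> outcome \<Rightarrow> bool" where
  "second_stage_outcome w P N q s \<longleftrightarrow>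
     second_stage_equilibrium w P N q s \<and>
     (\<forall>t. second_stage_equilibrium w P N q t \<longrightarrow> (\<forall>i. price s i \<le> price t i))"

definition nash_equilibrium ::
  "(country \<Rightarrow> real \<Rightarrow> real) \<Rightarrow> policy \<Rightarrow> nat \<Rightarrow> outcome \<Rightarrow> bool" where
  "nash_equilibrium w P N s \<longleftrightarrow>
     qexp s \<in> quantity_profiles N \<and> second_stage_outcome w P N (qexp s) s \<and>
     (\<forall>n\<in>{1..N}. \<forall>x\<in>{0..1 / real N}. \<forall>t.
        second_stage_outcome w P N ((qexp s)(n := x)) t \<longrightarrow>
        profit w P N (price t) (qdom t n) x \<le> profit w P N (price s) (qdom s n) (qexp s n))"

definition symmetric :: "nat \<Rightarrow> outcome \<Rightarrow> bool" where
  "symmetric N s \<longleftrightarrow>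
     (\<forall>n\<in>{1..N}. \<forall>n'\<in>{1..N}. qdom s n = qdom s n' \<and> qexp s n = qexp s n')"


section \<open>Conditional efficiency\<close>

text \<open>An allocation \<open>x\<close> gives the share \<open>x i j m\<close> of the markets of country \<open>j\<close> at product
  \<open>m\<close> that is served from country \<open>i\<close>.\<close>

type_synonym allocation = "country \<Rightarrow> country \<Rightarrow> real \<Rightarrow> real"

definition feasible :: "allocation \<Rightarrow> bool" where
  "feasible x \<longleftrightarrow>
     (\<forall>i j. x i j \<in> borel_measurable borel \<and> (\<forall>m\<in>{0..1}. 0 \<le> x i j m)) \<and>
     (\<forall>j. \<forall>m\<in>{0..1}. x CA j m + x CB j m = 1)"

definition total_production :: "allocation \<Rightarrow> country \<Rightarrow> real" where
  "total_production x i = (\<Sum>j\<in>{CA, CB}. LINT m:{0..1}|lborel. x i j m)"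

definition total_direct_cost :: "(country \<Rightarrow> real \<Rightarrow> real) \<Rightarrow> allocation \<Rightarrow> real" where
  "total_direct_cost w x = (\<Sum>i\<in>{CA, CB}. \<Sum>j\<in>{CA, CB}. LINT m:{0..1}|lborel. w i m * x i j m)"

definition conditionally_efficient :: "(country \<Rightarrow> real \<Rightarrow> real) \<Rightarrow> allocation \<Rightarrow> bool" where
  "conditionally_efficient w x \<longleftrightarrow>
     (\<forall>y. feasible y \<and> (\<forall>i. total_production y i = total_production x i) \<longrightarrow>
        total_direct_cost w x \<le> total_direct_cost w y)"

text \<open>At product \<open>m\<close>, country A serves the markets of those producers whose cutoff is at
  least \<open>m\<close>, each of them having density \<open>1 / N\<close>.\<close>

definition share_A :: "nat \<Rightarrow> (nat \<Rightarrow> real) \<Rightarrow> real \<Rightarrow> real" where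
  "share_A N q m = real (card {n\<in>{1..N}. m \<le> real N * q n}) / real N"

definition equilibrium_allocation :: "nat \<Rightarrow> outcome \<Rightarrow> allocation" where
  "equilibrium_allocation N s i j m =
     (let a = share_A N (case j of CA \<Rightarrow> qdom s | CB \<Rightarrow> qexp s) m
      in case i of CA \<Rightarrow> a | CB \<Rightarrow> 1 - a)"

end

theory Submission
  imports Defs
begin

text \<open>
  The first stage is reduced to a game in the export quantities alone. Given total exports \<open>Q\<close>,
  the lowest certificate prices supporting the second stage are explicit: while
  \<open>\<delta> (1 - \<eta> Q) \<ge> \<alpha>\<close>, A's certificate price is \<open>\<delta> (1 - \<eta> Q) - \<alpha>\<close> and B's is zero; beyond that
  point A's price is zero, and B's may become positive. In the first regime a producer's payoff is,
  up to the factor \<open>\<delta> / N\<close>, the quadratic \<open>K\<^sup>2 / 2 + K y - y\<^sup>2 / 2\<close> in its export cutoff \<open>y\<close>,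
  where \<open>K = 1 - \<eta> Q\<close> is the common margin in both markets, in units of \<open>\<delta>\<close>.

  No equilibrium has a zero price in A: since \<open>\<alpha> (1 + \<eta>) < \<delta>\<close>, some producer would export beyond the
  point \<open>\<alpha> / \<delta>\<close> where its margin vanishes, and would gain by cutting back to it. At a positive price
  the first-order condition \<open>K (1 - \<eta> / N) = (1 + \<eta> / N) y\<close> (or \<open>y = 0\<close> if \<open>N \<le> \<eta>\<close>) forces all
  cutoffs to coincide and has a unique solution.
\<close>

section \<open>Preliminaries\<close>

definition unit_clamp :: "real \<Rightarrow> real" where
  "unit_clamp r = max 0 (min 1 r)"

lemma unit_clamp_bounds: "0 \<le> unit_clamp r" "unit_clamp r \<le> 1"
  by (auto simp: unit_clamp_def)

lemma unit_clamp_eq: "0 \<le> r \<Longrightarrow> r \<le> 1 \<Longrightarrow> unit_clamp r = r"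
  by (auto simp: unit_clamp_def)

text \<open>Off the left end point clamping can only lower a value, off the right end point only
  raise it. These one-sided bounds turn inequalities on cutoffs back into inequalities on
  margins.\<close>

lemma unit_clamp_le: "0 < unit_clamp r \<Longrightarrow> unit_clamp r \<le> r"
  by (auto simp: unit_clamp_def)

lemma unit_clamp_ge: "unit_clamp r < 1 \<Longrightarrow> r \<le> unit_clamp r"
  by (auto simp: unit_clamp_def)

lemma unit_clamp_mono: "r \<le> r' \<Longrightarrow> unit_clamp r \<le> unit_clamp r'"
  by (auto simp: unit_clamp_def)

section \<open>Cutoffs and quadratic objectives on the unit interval\<close>

lemma measure_cutoff:
  fixes c d :: real
  assumes "0 < d"
  shows "measure lborel {m\<in>{0..1}. d * m \<le> c} = unit_clamp (c / d)"
proof -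
  have "{m\<in>{0..1}. d * m \<le> c} = {0..min 1 (c / d)}"
    using assms by (auto simp: field_simps)
  then show ?thesis
    by (auto simp: unit_clamp_def)
qed

text \<open>The clamped vertex \<open>y\<close> satisfies the variational inequality
  \<open>0 \<le> (y - x) * (k - d * y)\<close>, and this product is exactly the difference of the
  two sides. The squared term on the left makes the maximizer unique, not merely optimal.\<close>

lemma quadratic_max:
  fixes k d x :: real
  assumes "0 < d" "0 \<le> x" "x \<le> 1"
  defines "y \<equiv> unit_clamp (k / d)"
  shows "k * x - d * x\<^sup>2 / 2 + d * (y - x)\<^sup>2 / 2 \<le> k * y - d * y\<^sup>2 / 2"
proof -
  have "0 \<le> (y - x) * (k - d * y)"
  proof -
    consider "k \<le> 0" | "0 \<le> k" "k \<le> d" | "d \<le> k" by linarith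
    then show ?thesis
    proof cases
      case 1
      then have "k / d \<le> 0" using assms by (simp add: divide_nonpos_pos)
      then have "y = 0" by (simp add: y_def unit_clamp_def)
      then show ?thesis using 1 assms(2) by (simp add: mult_nonneg_nonpos)
    next
      case 2
      then have "y = k / d" using assms by (simp add: y_def unit_clamp_eq)
      then show ?thesis using assms(1) by simp
    next
      case 3
      then have "1 \<le> k / d" using assms(1) by simp
      then have "y = 1" by (simp add: y_def unit_clamp_def)
      then show ?thesis using 3 assms(3) by simp
    qed
  qed
  moreover have "k * y - d * y\<^sup>2 / 2 - (k * x - d * x\<^sup>2 / 2 + d * (y - x)\<^sup>2 / 2) = (y - x) * (k - d * y)"
    by (simp add: power2_eq_square field_simps)
  ultimately show ?thesis by linarith
qed

lemma set_integral_affine: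
  fixes c d y :: real
  assumes "0 \<le> y"
  shows "(LINT m:{0..y}|lborel. c - d * m) = c * y - d * y\<^sup>2 / 2"
proof -
  have "(\<integral>m. (c - d * m) * indicator {0..y} m \<partial>lborel) = (c * y - d * y\<^sup>2 / 2) - (c * 0 - d * 0\<^sup>2 / 2)"
    by (rule integral_FTC_Icc_real) (use assms in \<open>auto intro!: derivative_eq_intros\<close>)
  then show ?thesis
    by (simp add: set_lebesgue_integral_def mult.commute)
qed

lemma quadratic_le_vertex:
  fixes k d z :: real
  assumes "0 < d"
  shows "k * z - d * z\<^sup>2 / 2 \<le> k\<^sup>2 / (2 * d)"
proof -
  have "k\<^sup>2 / (2 * d) - (k * z - d * z\<^sup>2 / 2) = (k - d * z)\<^sup>2 / (2 * d)"
    using assms by (simp add: power2_eq_square field_simps)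
  moreover have "0 \<le> (k - d * z)\<^sup>2 / (2 * d)" using assms by simp
  ultimately show ?thesis by linarith
qed

lemma outcome_eqI:
  fixes s t :: outcome
  assumes "qdom s = qdom t" "qexp s = qexp t" "price s = price t"
  shows "s = t"
  using assms by (cases s; cases t) simp

lemma quantity_profiles_mem:
  "q \<in> quantity_profiles N \<Longrightarrow> n \<in> {1..N} \<Longrightarrow> q n \<in> {0..1 / real N}"
  by (auto simp: quantity_profiles_def PiE_def Pi_def)

text \<open>Both denominators are positive, and cross-multiplication leaves the difference
  \<open>2 * h * (y - x)\<close>.\<close>

lemma export_share_strict_mono:
  fixes h x y :: real
  assumes "1 < h" "h < x" "x < y"
  shows "(x - h) / (x * (h + 1) - h * (h - 1)) < (y - h) / (y * (h + 1) - h * (h - 1))"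
proof -
  have den: "0 < z * (h + 1) - h * (h - 1)" if "h < z" for z
    using mult_strict_right_mono[OF that, of "h + 1"] assms by (simp add: algebra_simps)
  have "(y - h) * (x * (h + 1) - h * (h - 1)) - (x - h) * (y * (h + 1) - h * (h - 1)) = 2 * h * (y - x)"
    by (simp add: algebra_simps)
  moreover have "0 < 2 * h * (y - x)" using assms by simp
  ultimately have "(x - h) * (y * (h + 1) - h * (h - 1)) < (y - h) * (x * (h + 1) - h * (h - 1))"
    by linarith
  then show ?thesis
    using den[of x] den[of y] assms by (simp add: frac_less_eq pos_divide_less_eq pos_less_divide_eq)
qed

lemma export_share_tendsto:
  fixes h :: real
  assumes "1 < h"
  shows "(\<lambda>N. (real N - h) / (real N * (h + 1) - h * (h - 1))) \<longlonglongrightarrow> 1 / (1 + h)"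
proof -
  have "(\<lambda>N. (1 - h / real N) / ((h + 1) - h * (h - 1) / real N)) \<longlonglongrightarrow> (1 - 0) / ((h + 1) - 0)"
    using assms by (intro tendsto_divide tendsto_diff tendsto_const lim_const_over_n) auto
  moreover have "\<forall>\<^sub>F N in sequentially. (1 - h / real N) / ((h + 1) - h * (h - 1) / real N)
      = (real N - h) / (real N * (h + 1) - h * (h - 1))"
    using eventually_gt_at_top[of 0]
  proof eventually_elim
    case (elim N)
    have "(real N - h) / (real N * (h + 1) - h * (h - 1))
        = ((real N - h) / real N) / ((real N * (h + 1) - h * (h - 1)) / real N)"
      using elim by simp
    also have "\<dots> = (1 - h / real N) / ((h + 1) - h * (h - 1) / real N)"
      using elim by (simp only: diff_divide_distrib) simp
    finally show ?case ..
  qed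
  ultimately show ?thesis by (simp add: tendsto_cong add.commute)
qed


section \<open>Certificate prices\<close>

text \<open>\<open>alpha_small\<close> expresses that the production goal exceeds free-trade
  production, since \<open>1 + eta P CA\<close> is two divided by the goal. Equivalently, the
  competitive certificate price \<open>(\<alpha> + \<beta>) / (1 + eta P CA) - \<alpha>\<close> is
  positive.\<close>

locale tic_trade =
  fixes \<alpha> \<beta> :: real and w :: "country \<Rightarrow> real \<Rightarrow> real" and P :: policy
  assumes alpha_pos: "0 < \<alpha>" and alpha_le_beta: "\<alpha> \<le> \<beta>"
    and tech: "technology \<alpha> \<beta> w"
    and tic_A: "tic P CA" and eta_gt_1: "1 < eta P CA"
    and phi_eta: "phi P CA * eta P CA = 1"
    and tic_B: "tic P CB \<Longrightarrow> 1 \<le> eta P CB \<and> 0 \<le> phi P CB"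
    and alpha_small: "\<alpha> * (1 + eta P CA) < \<alpha> + \<beta>"
begin

abbreviation "\<eta> \<equiv> eta P CA"
abbreviation "\<delta> \<equiv> \<alpha> + \<beta>"
abbreviation "\<psi> \<equiv> phi P CB * eta P CB"

text \<open>The two margins are A's gains at product 0; gains fall with slope \<delta> in the
  product. A's price enters both with coefficient one: B's exporters pay it at home, and A's
  exporters earn it abroad because \<open>phi P CA * eta P CA = 1\<close>.\<close>

definition dom_margin :: "(country \<Rightarrow> real) \<Rightarrow> real" where
  "dom_margin \<pi> = \<alpha> + \<pi> CA - \<psi> * \<pi> CB"

definition exp_margin :: "(country \<Rightarrow> real) \<Rightarrow> real" where
  "exp_margin \<pi> = \<alpha> + \<pi> CA - \<pi> CB"

definition dom_cutoff :: "(country \<Rightarrow> real) \<Rightarrow> real" where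
  "dom_cutoff \<pi> = unit_clamp (dom_margin \<pi> / \<delta>)"

lemma delta_pos: "0 < \<delta>"
  using alpha_pos alpha_le_beta by linarith

lemma psi_nonneg: "tic P CB \<Longrightarrow> 0 \<le> \<psi>"
  using tic_B by auto

lemma cost_diff: "m \<in> {0..1} \<Longrightarrow> w CA m - w CB m = - \<alpha> + \<delta> * m"
  using tech by (auto simp: technology_def)

lemma dom_gain:
  assumes "m \<in> {0..1}"
  shows "cost_exp w P \<pi> CB m - cost_dom w CA m = dom_margin \<pi> - \<delta> * m"
  using cost_diff[OF assms] by (simp add: cost_exp_def cost_dom_def dom_margin_def)

lemma exp_gain:
  assumes "m \<in> {0..1}"
  shows "cost_dom w CB m - cost_exp w P \<pi> CA m = exp_margin \<pi> - \<delta> * m"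
  using cost_diff[OF assms] phi_eta
  by (simp add: cost_exp_def cost_dom_def exp_margin_def)

text \<open>Domestic quantities are already eliminated: the optimal cutoff is common to all
  producers, each with density \<open>1 / N\<close>, so it equals A's total domestic production.
  Only prices and total exports remain.\<close>

definition clears :: "(country \<Rightarrow> real) \<Rightarrow> real \<Rightarrow> bool" where
  "clears \<pi> Q \<longleftrightarrow> certificate_equilibria P \<pi> (dom_cutoff \<pi>) Q"

text \<open>B's certificate price is positive only for \<open>Q > \<eta>\<^sub>B \<beta> / \<delta>\<close>: B's exports at zero prices,
  \<open>\<beta> / \<delta>\<close>, then generate too few certificates for its imports \<open>Q\<close>. If exporters of B receive no
  certificate revenues (\<open>\<psi> = 0\<close>), no price can raise B's exports, and such \<open>Q\<close> admits no second
  stage at all.\<close>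

definition low_price :: "real \<Rightarrow> country \<Rightarrow> real" where
  "low_price Q i = (case i of
     CA \<Rightarrow> max 0 (\<delta> * (1 - \<eta> * Q) - \<alpha>)
   | CB \<Rightarrow> if tic P CB \<and> eta P CB * \<beta> < \<delta> * Q
           then (\<alpha> - \<delta> * (1 - Q / eta P CB)) / \<psi> else 0)"

definition supportable :: "real \<Rightarrow> bool" where
  "supportable Q \<longleftrightarrow> (tic P CB \<and> eta P CB * \<beta> < \<delta> * Q \<longrightarrow> 0 < \<psi>)"

section \<open>Lowest clearing certificate prices\<close>

lemma clears_nonneg:
  assumes "clears \<pi> Q"
  shows "0 \<le> \<pi> CA" "0 \<le> \<pi> CB"
  using assms tic_A
  by (auto simp: clears_def certificate_equilibria_def certificate_equilibrium_def split: if_splits)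

text \<open>The sign of \<open>\<psi>\<close> is known only if B runs a scheme; otherwise B's price
  is zero and the product vanishes.\<close>

lemma clears_transfer_nonneg:
  assumes "clears \<pi> Q"
  shows "0 \<le> \<psi> * \<pi> CB"
proof (cases "tic P CB")
  case True
  then show ?thesis using psi_nonneg clears_nonneg[OF assms] by simp
next
  case False
  then show ?thesis using assms
    by (simp add: clears_def certificate_equilibria_def certificate_equilibrium_def)
qed

text \<open>A's certificate market bounds the domestic cutoff from below by
  \<open>1 - \<eta> * Q\<close>, which forces the domestic margin, and with it A's price, up. B's
  market bounds the same cutoff from above, which forces the margin down and hence B's price up;
  this is impossible if \<open>\<psi>\<close> is zero.\<close>

lemma clears_lower_bound:
  assumes c: "clears \<pi> Q" and Q: "0 \<le> Q" "Q \<le> 1"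
  shows "supportable Q" and "low_price Q i \<le> \<pi> i"
proof -
  have A: "\<delta> * (1 - \<eta> * Q) - \<alpha> \<le> \<pi> CA"
  proof (cases "0 < 1 - \<eta> * Q")
    case True
    have le: "1 - \<eta> * Q \<le> dom_cutoff \<pi>"
      using c tic_A by (simp add: clears_def certificate_equilibria_def certificate_equilibrium_def)
    with True have "dom_cutoff \<pi> \<le> dom_margin \<pi> / \<delta>"
      unfolding dom_cutoff_def by (intro unit_clamp_le) linarith
    with le have "1 - \<eta> * Q \<le> dom_margin \<pi> / \<delta>" by linarith
    then have "(1 - \<eta> * Q) * \<delta> \<le> dom_margin \<pi>"
      using delta_pos by (simp add: pos_le_divide_eq)
    then show ?thesis
      using clears_transfer_nonneg[OF c] by (simp add: dom_margin_def algebra_simps)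
  next
    case False
    then have "\<delta> * (1 - \<eta> * Q) \<le> 0" using delta_pos by (simp add: mult_nonneg_nonpos)
    then show ?thesis using clears_nonneg[OF c] alpha_pos by linarith
  qed
  have B: "0 < \<psi> \<and> (\<alpha> - \<delta> * (1 - Q / eta P CB)) / \<psi> \<le> \<pi> CB"
    if t: "tic P CB" and Qb: "eta P CB * \<beta> < \<delta> * Q"
  proof -
    let ?D = "dom_cutoff \<pi>" and ?b = "eta P CB"
    have b: "1 \<le> ?b" using tic_B[OF t] by simp
    have "Q \<le> ?b * (1 - ?D)"
      using c t by (simp add: clears_def certificate_equilibria_def certificate_equilibrium_def)
    then have D: "?D \<le> 1 - Q / ?b"
      using b by (simp add: field_simps)
    have *: "\<beta> < \<delta> * (Q / ?b)" using Qb b by (simp add: field_simps)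
    then have "0 < Q / ?b"
      using delta_pos alpha_pos alpha_le_beta by (smt (verit) mult_nonneg_nonpos)
    with D have "dom_margin \<pi> / \<delta> \<le> ?D"
      unfolding dom_cutoff_def by (intro unit_clamp_ge) linarith
    with D have "dom_margin \<pi> / \<delta> \<le> 1 - Q / ?b" by linarith
    then have "dom_margin \<pi> \<le> (1 - Q / ?b) * \<delta>"
      using delta_pos by (simp add: pos_divide_le_eq)
    then have **: "\<alpha> - \<delta> * (1 - Q / ?b) \<le> \<psi> * \<pi> CB"
      using clears_nonneg[OF c] by (simp add: dom_margin_def mult.commute)
    moreover have "0 < \<alpha> - \<delta> * (1 - Q / ?b)" using * by (simp add: algebra_simps)
    ultimately have "\<psi> \<noteq> 0" by auto
    with psi_nonneg[OF t] have "0 < \<psi>" by linarith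
    with ** show ?thesis by (simp add: pos_divide_le_eq mult.commute)
  qed
  show "supportable Q" using B by (auto simp: supportable_def)
  show "low_price Q i \<le> \<pi> i"
    using A B clears_nonneg[OF c] by (cases i) (auto simp: low_price_def)
qed

lemma low_price_dom_cutoff:
  assumes "supportable Q" "0 \<le> Q" "Q \<le> 1"
  shows "dom_cutoff (low_price Q) =
     (if tic P CB \<and> eta P CB * \<beta> < \<delta> * Q then 1 - Q / eta P CB else max (\<alpha> / \<delta>) (1 - \<eta> * Q))"
    (is "_ = (if ?III then _ else _)")
proof (cases ?III)
  case True
  let ?b = "eta P CB"
  from True tic_B have b: "1 \<le> ?b" by simp
  \<comment> \<open>Exports large enough to make B's price positive satisfy
    \<open>\<beta> < \<delta> * (\<eta> * Q)\<close>, so A's price is zero: the two prices are never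
    positive together.\<close>
  have "\<beta> \<le> ?b * \<beta>" using b alpha_pos alpha_le_beta by simp
  also have "\<dots> < \<delta> * Q" using True by simp
  also have "\<dots> \<le> \<delta> * (\<eta> * Q)"
    using eta_gt_1 delta_pos assms(2) mult_right_mono[of 1 \<eta> Q] by (intro mult_left_mono) auto
  finally have "low_price Q CA = 0" by (simp add: low_price_def algebra_simps)
  moreover have "\<psi> \<noteq> 0" using True assms(1) by (auto simp: supportable_def)
  ultimately have "dom_margin (low_price Q) = \<delta> * (1 - Q / ?b)"
    using True by (simp add: dom_margin_def low_price_def)
  moreover have "0 \<le> 1 - Q / ?b" "1 - Q / ?b \<le> 1"
    using b assms by (auto simp: field_simps)
  ultimately show ?thesis
    using True delta_pos by (simp add: dom_cutoff_def unit_clamp_eq)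
next
  case False
  then have "dom_margin (low_price Q) = max \<alpha> (\<delta> * (1 - \<eta> * Q))"
    by (auto simp: dom_margin_def low_price_def max_def)
  also have "\<dots> = \<delta> * max (\<alpha> / \<delta>) (1 - \<eta> * Q)"
    using delta_pos by (simp add: max_mult_distrib_left)
  finally have "dom_margin (low_price Q) / \<delta> = max (\<alpha> / \<delta>) (1 - \<eta> * Q)"
    using delta_pos by simp
  moreover have "0 \<le> max (\<alpha> / \<delta>) (1 - \<eta> * Q)" "max (\<alpha> / \<delta>) (1 - \<eta> * Q) \<le> 1"
    using alpha_pos alpha_le_beta eta_gt_1 assms by (auto simp: le_max_iff_disj)
  ultimately show ?thesis
    unfolding dom_cutoff_def if_not_P[OF False] by (simp only: unit_clamp_eq)
qed

text \<open>If B's price is positive, B's market binds and A's is non-binding. Otherwise A's market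
  binds as long as \<open>\<alpha> / \<delta> \<le> 1 - \<eta> * Q\<close>, degenerating to pure
  autarky at \<open>Q = 0\<close>, and is non-binding beyond; B's market is then slack at price zero
  or autarkic as well.\<close>

lemma clears_low_price:
  assumes "supportable Q" "0 \<le> Q" "Q \<le> 1"
  shows "clears (low_price Q) Q"
proof (cases "tic P CB \<and> eta P CB * \<beta> < \<delta> * Q")
  case True
  let ?b = "eta P CB"
  from True tic_B have b: "1 \<le> ?b" by simp
  have Dl: "dom_cutoff (low_price Q) = 1 - Q / ?b"
    using low_price_dom_cutoff[OF assms] True by simp
  have "\<beta> \<le> ?b * \<beta>" using b alpha_pos alpha_le_beta by simp
  with True have lt: "\<beta> < \<delta> * Q" by linarith
  then have Q: "0 < Q" using delta_pos alpha_pos alpha_le_beta assms by (cases "Q = 0") auto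
  have le: "\<delta> * Q \<le> \<delta> * (\<eta> * Q)"
    using eta_gt_1 delta_pos assms(2) mult_right_mono[of 1 \<eta> Q] by (intro mult_left_mono) auto
  with lt have pA: "low_price Q CA = 0" by (simp add: low_price_def algebra_simps)
  have "\<beta> < \<delta> * (Q / ?b)" using True b by (simp add: field_simps)
  moreover have "0 < \<psi>" using True assms(1) by (auto simp: supportable_def)
  ultimately have pB: "0 \<le> low_price Q CB"
    using True by (auto simp: low_price_def algebra_simps intro!: divide_nonneg_pos)
  have "Q / ?b \<le> Q / 1" using b Q by (intro divide_left_mono) auto
  also have "\<dots> \<le> \<eta> * Q" using eta_gt_1 Q by simp
  finally show ?thesis
    using Q b pA pB True tic_A
    by (auto simp: clears_def certificate_equilibria_def certificate_equilibrium_def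
        Dl binding_def non_binding_def)
next
  case False
  define D where "D = dom_cutoff (low_price Q)"
  have D: "D = max (\<alpha> / \<delta>) (1 - \<eta> * Q)"
    using low_price_dom_cutoff[OF assms] False by (simp only: D_def if_False)
  have pB: "low_price Q CB = 0" using False by (auto simp: low_price_def)
  have a1: "\<alpha> / \<delta> < 1" using alpha_pos alpha_le_beta by simp
  show ?thesis
  proof (cases "\<alpha> / \<delta> \<le> 1 - \<eta> * Q")
    case True
    then have D1: "D = 1 - \<eta> * Q" using D by simp
    have "\<alpha> \<le> \<delta> * (1 - \<eta> * Q)" using True delta_pos by (simp add: field_simps)
    then have A: "certificate_equilibrium P CA (low_price Q CA) Q (1 - D)"
      using tic_A assms eta_gt_1
      by (auto simp: certificate_equilibrium_def binding_def pure_autarky_def D1 low_price_def)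
    have "Q \<le> eta P CB * (\<eta> * Q)" if "tic P CB"
      using tic_B[OF that] eta_gt_1 assms(2)
      by (metis (no_types, opaque_lifting) less_eq_real_def mult_left_mono mult_right_mono mult_1 order_trans zero_le_one)
    then have "certificate_equilibrium P CB 0 (1 - D) Q"
      using assms eta_gt_1
      by (auto simp: certificate_equilibrium_def non_binding_def pure_autarky_def D1)
    with A show ?thesis
      by (simp add: clears_def certificate_equilibria_def pB flip: D_def)
  next
    case c: False
    then have D1: "D = \<alpha> / \<delta>" using D by simp
    have Q: "0 < Q" using c a1 assms(2) by (cases "Q = 0") auto
    have "\<delta> * (1 - \<eta> * Q) \<le> \<alpha>" using c delta_pos by (simp add: field_simps)
    then have A: "certificate_equilibrium P CA (low_price Q CA) Q (1 - D)"
      using tic_A c Q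
      by (auto simp: certificate_equilibrium_def non_binding_def D1 low_price_def)
    have e: "1 - D = \<beta> / \<delta>" using delta_pos by (simp add: D1 field_simps)
    have "Q \<le> eta P CB * (1 - D)" if "tic P CB"
      using False that delta_pos unfolding e by (simp add: field_simps)
    then have "certificate_equilibrium P CB 0 (1 - D) Q"
      using a1 by (auto simp: certificate_equilibrium_def non_binding_def D1)
    with A show ?thesis
      by (simp add: clears_def certificate_equilibria_def pB flip: D_def)
  qed
qed

text \<open>The hypothesis gives \<open>\<delta> * Q \<le> \<beta>\<close>, so B's exports generate
  enough certificates at price zero. A's certificate constraint alone then pins down domestic
  production.\<close>

lemma low_export:
  assumes "0 \<le> Q" "\<alpha> \<le> \<delta> * (1 - \<eta> * Q)"
  shows "supportable Q" "low_price Q CA = \<delta> * (1 - \<eta> * Q) - \<alpha>" "low_price Q CB = 0"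
    "dom_cutoff (low_price Q) = 1 - \<eta> * Q"
proof -
  have no: "\<not> (tic P CB \<and> eta P CB * \<beta> < \<delta> * Q)"
  proof
    assume t: "tic P CB \<and> eta P CB * \<beta> < \<delta> * Q"
    have "\<delta> * Q \<le> \<delta> * (\<eta> * Q)"
      using eta_gt_1 delta_pos assms(1) mult_right_mono[of 1 \<eta> Q] by (intro mult_left_mono) auto
    also have "\<dots> \<le> \<beta>" using assms(2) by (simp add: algebra_simps)
    also have "\<dots> \<le> eta P CB * \<beta>" using t tic_B alpha_pos alpha_le_beta by simp
    finally show False using t by simp
  qed
  then show "supportable Q" by (auto simp: supportable_def)
  show A: "low_price Q CA = \<delta> * (1 - \<eta> * Q) - \<alpha>" using assms by (simp add: low_price_def)
  show B: "low_price Q CB = 0" using no by (auto simp: low_price_def)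
  have "dom_margin (low_price Q) / \<delta> = 1 - \<eta> * Q"
    using A B delta_pos by (simp add: dom_margin_def)
  moreover have "0 < \<delta> * (1 - \<eta> * Q)" using assms alpha_pos by linarith
  then have "0 \<le> 1 - \<eta> * Q" using delta_pos by (simp add: zero_less_mult_iff)
  moreover have "1 - \<eta> * Q \<le> 1" using assms eta_gt_1 by simp
  ultimately show "dom_cutoff (low_price Q) = 1 - \<eta> * Q"
    by (simp add: dom_cutoff_def unit_clamp_eq)
qed

text \<open>Cutting exports makes certificates scarcer in A and less demanded in B, and both price
  changes favour A's producers. The version with factor \<open>\<psi>\<close> is stated separately
  because \<open>\<psi>\<close> has a known sign only if B runs a scheme.\<close>

lemma low_price_mono:
  assumes "supportable Q" "Q' \<le> Q"
  shows "supportable Q'" "low_price Q CA \<le> low_price Q' CA"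
    "low_price Q' CB \<le> low_price Q CB"
    "\<psi> * low_price Q' CB \<le> \<psi> * low_price Q CB"
proof -
  have dQ: "\<delta> * Q' \<le> \<delta> * Q" using assms delta_pos by (intro mult_left_mono) auto
  with assms show "supportable Q'" by (auto simp: supportable_def)
  have "\<delta> * (1 - \<eta> * Q) \<le> \<delta> * (1 - \<eta> * Q')"
    using assms delta_pos eta_gt_1 by (intro mult_left_mono) auto
  then show "low_price Q CA \<le> low_price Q' CA" by (auto simp: low_price_def)
  have B: "low_price Q' CB \<le> low_price Q CB \<and> \<psi> * low_price Q' CB \<le> \<psi> * low_price Q CB"
  proof (cases "tic P CB \<and> eta P CB * \<beta> < \<delta> * Q")
    case True
    then have psi: "0 < \<psi>" and b: "1 \<le> eta P CB"
      using assms tic_B by (auto simp: supportable_def)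
    define R where "R q = \<alpha> - \<delta> * (1 - q / eta P CB)" for q
    have "Q' / eta P CB \<le> Q / eta P CB" using b assms by (intro divide_right_mono) auto
    then have "\<delta> * (1 - Q / eta P CB) \<le> \<delta> * (1 - Q' / eta P CB)"
      using delta_pos by (intro mult_left_mono) auto
    then have "R Q' \<le> R Q" by (simp add: R_def)
    then have "R Q' / \<psi> \<le> R Q / \<psi>" using psi by (intro divide_right_mono) auto
    moreover have "0 \<le> R Q"
    proof -
      have "\<beta> < \<delta> * (Q / eta P CB)" using True b by (simp add: field_simps)
      then show ?thesis by (simp add: R_def algebra_simps)
    qed
    then have "0 \<le> R Q / \<psi>" using psi by simp
    ultimately have "low_price Q' CB \<le> low_price Q CB"
      using True by (simp add: low_price_def R_def)
    then show ?thesis using mult_left_mono[OF _ less_imp_le[OF psi]] by blast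
  next
    case False
    then have "\<not> (tic P CB \<and> eta P CB * \<beta> < \<delta> * Q')" using dQ by auto
    with False have "low_price Q CB = 0" "low_price Q' CB = 0" by (auto simp: low_price_def)
    then show ?thesis by simp
  qed
  then show "low_price Q' CB \<le> low_price Q CB"
    "\<psi> * low_price Q' CB \<le> \<psi> * low_price Q CB" by auto
qed

end


section \<open>Direct cost of cutoff allocations\<close>

definition cutoff_allocation :: "(country \<Rightarrow> real) \<Rightarrow> allocation" where
  "cutoff_allocation d i j m =
     (let a = (if m \<le> d j then 1 else 0) in case i of CA \<Rightarrow> a | CB \<Rightarrow> 1 - a)"

text \<open>With a common cutoff the densities \<open>1 / N\<close> add up to one below it and to
  zero above, so a symmetric outcome is an ordinary cutoff allocation.\<close>

lemma share_A_uniform: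
  assumes "1 \<le> N"
  shows "share_A N (\<lambda>n\<in>{1..N}. c / real N) m = (if m \<le> c then 1 else 0)"
proof -
  have "{n\<in>{1..N}. m \<le> real N * (\<lambda>n\<in>{1..N}. c / real N) n} = (if m \<le> c then {1..N} else {})"
    using assms by auto
  then show ?thesis using assms by (simp add: share_A_def)
qed

lemma equilibrium_allocation_uniform:
  assumes "1 \<le> N" "qdom s = (\<lambda>n\<in>{1..N}. d CA / real N)" "qexp s = (\<lambda>n\<in>{1..N}. d CB / real N)"
  shows "equilibrium_allocation N s = cutoff_allocation d"
proof (intro ext)
  fix i j m
  show "equilibrium_allocation N s i j m = cutoff_allocation d i j m"
    by (cases j) (simp_all only: equilibrium_allocation_def cutoff_allocation_def country.case
        assms(2,3) share_A_uniform[OF assms(1)])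
qed

lemma feasible_cutoff_allocation: "feasible (cutoff_allocation d)"
proof -
  have "cutoff_allocation d i j \<in> borel_measurable borel" for i j
    by (cases i) (simp_all add: cutoff_allocation_def[abs_def])
  moreover have "0 \<le> cutoff_allocation d i j m" for i j m
    by (cases i) (simp_all add: cutoff_allocation_def)
  ultimately show ?thesis by (simp add: feasible_def) (simp add: cutoff_allocation_def)
qed

lemma cutoff_integrals:
  fixes f :: "real \<Rightarrow> real"
  assumes "0 \<le> d" "d \<le> 1" and f: "set_integrable lborel {0..1} f"
  shows "(LINT m:{0..1}|lborel. f m * (if m \<le> d then 1 else 0)) = (LINT m:{0..d}|lborel. f m)"
    and "(LINT m:{0..1}|lborel. f m * (1 - (if m \<le> d then 1 else 0)))
      = (LINT m:{0..1}|lborel. f m) - (LINT m:{0..d}|lborel. f m)"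
proof -
  have i: "indicat_real {0..1} m *\<^sub>R (f m * (if m \<le> d then 1 else 0)) = indicat_real {0..d} m *\<^sub>R f m" for m
    using assms by (auto simp: indicator_def)
  have i': "indicat_real {0..1} m *\<^sub>R (f m * (1 - (if m \<le> d then 1 else 0)))
      = indicat_real {0..1} m *\<^sub>R f m - indicat_real {0..d} m *\<^sub>R f m" for m
    using assms by (auto simp: indicator_def)
  show "(LINT m:{0..1}|lborel. f m * (if m \<le> d then 1 else 0)) = (LINT m:{0..d}|lborel. f m)"
    unfolding set_lebesgue_integral_def i ..
  have "set_integrable lborel {0..d} f"
    using assms by (intro set_integrable_subset[OF f]) auto
  then show "(LINT m:{0..1}|lborel. f m * (1 - (if m \<le> d then 1 else 0)))
      = (LINT m:{0..1}|lborel. f m) - (LINT m:{0..d}|lborel. f m)"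
    using f unfolding set_lebesgue_integral_def set_integrable_def i'
    by (intro Bochner_Integration.integral_diff)
qed

lemma total_production_cutoff_allocation:
  assumes d: "\<And>j. 0 \<le> d j \<and> d j \<le> 1"
  shows "total_production (cutoff_allocation d) i
    = (case i of CA \<Rightarrow> d CA + d CB | CB \<Rightarrow> 2 - (d CA + d CB))"
proof -
  have one: "set_integrable lborel {0..1::real} (\<lambda>_. 1 :: real)"
    by (simp add: set_integrable_def)
  have int1: "(LINT m:{0..y}|lborel. 1 :: real) = y" if "0 \<le> y" for y :: real
    using set_integral_affine[OF that, of 1 0] by simp
  have "(LINT m:{0..1}|lborel. cutoff_allocation d i j m) = (case i of CA \<Rightarrow> d j | CB \<Rightarrow> 1 - d j)" for j
    using cutoff_integrals[OF _ _ one, of "d j"] d[of j] int1[of "d j"] int1[of 1]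
    by (cases i) (simp_all add: cutoff_allocation_def)
  then show ?thesis by (cases i) (simp_all add: total_production_def)
qed

context tic_trade
begin

text \<open>Start from B serving everything and move the products below each cutoff to A; product
  \<open>m\<close> changes the cost by \<open>- \<alpha> + \<delta> * m\<close>.\<close>

lemma total_direct_cost_cutoff_allocation:
  assumes d: "\<And>j. 0 \<le> d j \<and> d j \<le> 1"
  shows "total_direct_cost w (cutoff_allocation d) = 2 * (LINT m:{0..1}|lborel. w CB m)
    - \<alpha> * (d CA + d CB) + \<delta> * ((d CA)\<^sup>2 + (d CB)\<^sup>2) / 2"
proof -
  have int: "set_integrable lborel {0..1} (w i)" for i using tech by (simp add: technology_def)
  have diff: "(LINT m:{0..y}|lborel. w CA m) - (LINT m:{0..y}|lborel. w CB m) = - \<alpha> * y + \<delta> * y\<^sup>2 / 2"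
    if "0 \<le> y" "y \<le> 1" for y
  proof -
    have si: "set_integrable lborel {0..y} (w i)" for i
      using that by (intro set_integrable_subset[OF int]) auto
    have "(LINT m:{0..y}|lborel. w CA m) - (LINT m:{0..y}|lborel. w CB m)
        = (LINT m:{0..y}|lborel. w CA m - w CB m)"
      using set_integral_diff(2)[OF si si] by simp
    also have "\<dots> = (LINT m:{0..y}|lborel. - \<alpha> - (- \<delta>) * m)"
      using that by (intro set_lebesgue_integral_cong) (auto simp: cost_diff algebra_simps)
    also have "\<dots> = - \<alpha> * y - (- \<delta>) * y\<^sup>2 / 2" by (rule set_integral_affine[OF that(1)])
    finally show ?thesis by (simp only: mult_minus_left minus_divide_left[symmetric] diff_minus_eq_add)
  qed
  have each: "(LINT m:{0..1}|lborel. w CA m * cutoff_allocation d CA j m)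
      + (LINT m:{0..1}|lborel. w CB m * cutoff_allocation d CB j m)
      = (LINT m:{0..1}|lborel. w CB m) + (- \<alpha> * d j + \<delta> * (d j)\<^sup>2 / 2)" for j
    using cutoff_integrals[OF _ _ int, of "d j"] diff[of "d j"] d[of j]
    by (simp add: cutoff_allocation_def)
  have "total_direct_cost w (cutoff_allocation d)
      = 2 * (LINT m:{0..1}|lborel. w CB m) + (- \<alpha> * d CA + \<delta> * (d CA)\<^sup>2 / 2) + (- \<alpha> * d CB + \<delta> * (d CB)\<^sup>2 / 2)"
    using each[of CA] each[of CB] by (simp add: total_direct_cost_def)
  then show ?thesis by (simp add: field_simps)
qed

text \<open>Replacing both cutoffs by their mean \<open>h\<close> keeps total productions, which
  depend only on the sum of the cutoffs, and lowers the cost by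
  \<open>\<delta> * (d CA - d CB)\<^sup>2 / 4\<close> by strict convexity.\<close>

lemma cutoff_allocation_inefficient:
  assumes d: "\<And>j. 0 \<le> d j \<and> d j \<le> 1" and ne: "d CA \<noteq> d CB"
  shows "\<not> conditionally_efficient w (cutoff_allocation d)"
proof
  define h where "h = (d CA + d CB) / 2"
  have hh: "h + h = d CA + d CB" by (simp add: h_def)
  have h: "0 \<le> h \<and> h \<le> 1" using d[of CA] d[of CB] by (simp add: h_def)
  assume "conditionally_efficient w (cutoff_allocation d)"
  moreover have "total_production (cutoff_allocation (\<lambda>_. h)) i = total_production (cutoff_allocation d) i" for i
    using d h by (cases i) (simp_all only: total_production_cutoff_allocation country.case hh)
  ultimately have "total_direct_cost w (cutoff_allocation d) \<le> total_direct_cost w (cutoff_allocation (\<lambda>_. h))"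
    using feasible_cutoff_allocation by (simp add: conditionally_efficient_def)
  with hh have "\<delta> * ((d CA)\<^sup>2 + (d CB)\<^sup>2) / 2 \<le> \<delta> * (h\<^sup>2 + h\<^sup>2) / 2"
    unfolding total_direct_cost_cutoff_allocation[OF d] total_direct_cost_cutoff_allocation[of "\<lambda>_. h", OF h]
    by simp
  then have "(d CA)\<^sup>2 + (d CB)\<^sup>2 \<le> h\<^sup>2 + h\<^sup>2" using delta_pos by simp
  moreover have "(d CA)\<^sup>2 + (d CB)\<^sup>2 - (h\<^sup>2 + h\<^sup>2) = (d CA - d CB)\<^sup>2 / 2"
    by (simp add: h_def power2_eq_square field_simps)
  moreover have "0 < (d CA - d CB)\<^sup>2" using ne by simp
  ultimately show False by linarith
qed

end


section \<open>Perfect competition\<close>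

context tic_trade
begin

lemma competitive_equilibrium_iff:
  "competitive_equilibrium w P Qd Qe \<pi> \<longleftrightarrow>
     Qd = dom_cutoff \<pi> \<and> Qe = unit_clamp (exp_margin \<pi> / \<delta>) \<and> certificate_equilibria P \<pi> Qd Qe"
proof -
  have "{m\<in>{0..1}. cost_dom w CA m \<le> cost_exp w P \<pi> CB m} = {m\<in>{0..1}. \<delta> * m \<le> dom_margin \<pi>}"
  proof (intro Collect_cong conj_cong refl)
    fix m :: real assume "m \<in> {0..1}"
    from dom_gain[OF this, of \<pi>] show "(cost_dom w CA m \<le> cost_exp w P \<pi> CB m) = (\<delta> * m \<le> dom_margin \<pi>)"
      by linarith
  qed
  moreover have "{m\<in>{0..1}. cost_exp w P \<pi> CA m \<le> cost_dom w CB m} = {m\<in>{0..1}. \<delta> * m \<le> exp_margin \<pi>}"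
  proof (intro Collect_cong conj_cong refl)
    fix m :: real assume "m \<in> {0..1}"
    from exp_gain[OF this, of \<pi>] show "(cost_exp w P \<pi> CA m \<le> cost_dom w CB m) = (\<delta> * m \<le> exp_margin \<pi>)"
      by linarith
  qed
  ultimately show ?thesis
    using measure_cutoff[OF delta_pos]
    by (simp add: competitive_equilibrium_def dom_cutoff_def)
qed

text \<open>\<open>Qe > 0\<close> rules out pure autarky. B's price must then vanish, so both
  cutoffs coincide. A binding constraint in A yields \<open>1 / (1 + \<eta>)\<close>; a zero price
  in A would leave exports at \<open>\<alpha> / \<delta>\<close>, which by
  \<open>alpha_small\<close> generate too few certificates.\<close>

lemma competitive_trade_iff:
  "competitive_equilibrium w P Qd Qe \<pi> \<and> Qe > 0 \<longleftrightarrow>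
     Qd = 1 / (1 + \<eta>) \<and> Qe = 1 / (1 + \<eta>) \<and> \<pi> CA = \<delta> / (1 + \<eta>) - \<alpha> \<and> \<pi> CB = 0"
  (is "?L \<longleftrightarrow> ?R")
proof
  have a_small: "\<alpha> / \<delta> * (1 + \<eta>) < 1" using alpha_small delta_pos by (simp add: field_simps)
  have "\<alpha> / \<delta> \<le> 1 / 2"
    using alpha_le_beta delta_pos by (simp add: pos_divide_le_eq)
  then have a_half: "\<alpha> / \<delta> + \<alpha> / \<delta> \<le> 1" by linarith
  {
    assume L: ?L
    then have Qd: "Qd = unit_clamp (dom_margin \<pi> / \<delta>)" and Qe: "Qe = unit_clamp (exp_margin \<pi> / \<delta>)"
      and ce: "certificate_equilibria P \<pi> Qd Qe" and pos: "0 < Qe"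
      by (auto simp: competitive_equilibrium_iff dom_cutoff_def)
    have c: "clears \<pi> Qe" using ce Qd by (simp add: clears_def dom_cutoff_def)
    have A: "binding \<eta> (\<pi> CA) Qe (1 - Qd) \<or> non_binding \<eta> (\<pi> CA) Qe (1 - Qd)"
      using ce pos tic_A
      by (auto simp: certificate_equilibria_def certificate_equilibrium_def pure_autarky_def)
    \<comment> \<open>A positive price in B makes B's constraint bind, so A imports at most what it
      exports, its own constraint is slack and its price is zero. Both cutoffs are then at most
      \<open>\<alpha> / \<delta>\<close>, the export one strictly, yet
      \<open>1 - Qd \<le> Qe\<close> makes their sum at least one, against
      \<open>\<alpha> \<le> \<beta>\<close>.\<close>
    have B0: "\<pi> CB = 0"
    proof (rule ccontr)
      assume nz: "\<pi> CB \<noteq> 0"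
      then have t: "tic P CB" and b: "eta P CB * (1 - Qd) = Qe"
        using ce pos
        by (auto simp: certificate_equilibria_def certificate_equilibrium_def pure_autarky_def
            binding_def non_binding_def split: if_splits)
      have b1: "1 \<le> eta P CB" using tic_B[OF t] by simp
      have D: "0 \<le> 1 - Qd" by (simp add: Qd unit_clamp_bounds)
      then have le: "1 - Qd \<le> Qe" using b b1 mult_right_mono[of 1 "eta P CB" "1 - Qd"] by simp
      have "\<eta> * Qe \<noteq> 1 - Qd"
        using le pos eta_gt_1 mult_strict_right_mono[OF eta_gt_1 pos] by linarith
      with A have pA: "\<pi> CA = 0" by (auto simp: binding_def non_binding_def)
      have "exp_margin \<pi> \<le> \<alpha>" using pA clears_nonneg[OF c] by (simp add: exp_margin_def)
      moreover have "exp_margin \<pi> \<noteq> \<alpha>" using pA nz by (simp add: exp_margin_def)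
      ultimately have "exp_margin \<pi> / \<delta> < \<alpha> / \<delta>" using delta_pos by (intro divide_strict_right_mono) auto
      moreover have "Qe \<le> exp_margin \<pi> / \<delta>" using pos unfolding Qe by (rule unit_clamp_le)
      ultimately have Qe_lt: "Qe < \<alpha> / \<delta>" by linarith
      have "dom_margin \<pi> \<le> \<alpha>" using pA clears_transfer_nonneg[OF c] by (simp add: dom_margin_def)
      then have "dom_margin \<pi> / \<delta> \<le> \<alpha> / \<delta>" using delta_pos by (intro divide_right_mono) auto
      then have "Qd \<le> unit_clamp (\<alpha> / \<delta>)" unfolding Qd by (rule unit_clamp_mono)
      also have "\<dots> = \<alpha> / \<delta>" using alpha_pos alpha_le_beta by (intro unit_clamp_eq) auto
      finally show False using le Qe_lt a_half by linarith
    qed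
    have same: "dom_margin \<pi> = \<alpha> + \<pi> CA" "exp_margin \<pi> = \<alpha> + \<pi> CA"
      using B0 by (simp_all add: dom_margin_def exp_margin_def)
    then have eq: "Qd = Qe" using Qd Qe by simp
    have Qe': "Qe = 1 / (1 + \<eta>)"
    proof -
      from A consider "\<eta> * Qe = 1 - Qe" | "\<pi> CA = 0" "1 - Qe \<le> \<eta> * Qe"
        by (auto simp: binding_def non_binding_def eq)
      then show ?thesis
      proof cases
        case 1
        then have "Qe * (1 + \<eta>) = 1" by (simp add: algebra_simps)
        then show ?thesis using eta_gt_1 by (simp add: nonzero_eq_divide_eq)
      next
        case 2
        then have "Qe = \<alpha> / \<delta>"
          using Qe same alpha_pos alpha_le_beta by (simp add: unit_clamp_eq)
        then have "1 - \<alpha> / \<delta> \<le> \<eta> * (\<alpha> / \<delta>)" using 2 by simp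
        moreover have "\<alpha> / \<delta> * (1 + \<eta>) = \<alpha> / \<delta> + \<eta> * (\<alpha> / \<delta>)"
          by (simp only: distrib_left mult_1_right mult.commute[of \<eta>])
        ultimately show ?thesis using a_small by linarith
      qed
    qed
    then have "0 < Qe" "Qe < 1" using eta_gt_1 by simp_all
    then have "exp_margin \<pi> / \<delta> = Qe"
      using unit_clamp_le[of "exp_margin \<pi> / \<delta>"] unit_clamp_ge[of "exp_margin \<pi> / \<delta>"] Qe by simp
    then have "\<alpha> + \<pi> CA = Qe * \<delta>" using delta_pos same by (simp add: nonzero_divide_eq_eq)
    then have "\<pi> CA = \<delta> / (1 + \<eta>) - \<alpha>" using Qe' by simp
    then show ?R using Qe' eq B0 by simp
  }
  {
    assume R: ?R
    have m: "dom_margin \<pi> / \<delta> = 1 / (1 + \<eta>)" "exp_margin \<pi> / \<delta> = 1 / (1 + \<eta>)"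
      using R delta_pos by (simp_all add: dom_margin_def exp_margin_def)
    have "0 \<le> 1 / (1 + \<eta>)" "1 / (1 + \<eta>) \<le> 1" using eta_gt_1 by simp_all
    then have cut: "unit_clamp (1 / (1 + \<eta>)) = 1 / (1 + \<eta>)" by (rule unit_clamp_eq)
    have imp: "1 - 1 / (1 + \<eta>) = \<eta> * (1 / (1 + \<eta>))" using eta_gt_1 by (simp add: field_simps)
    have pos: "0 < 1 / (1 + \<eta>)" using eta_gt_1 by simp
    have "\<alpha> \<le> \<delta> / (1 + \<eta>)" using alpha_small eta_gt_1 by (simp add: pos_le_divide_eq)
    then have "certificate_equilibrium P CA (\<pi> CA) Qe (1 - Qd)"
      using R imp pos eta_gt_1 tic_A by (simp add: certificate_equilibrium_def binding_def)
    moreover have "Qe \<le> eta P CB * (1 - Qd)" if "tic P CB"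
    proof -
      have "1 \<le> eta P CB * \<eta>"
        using tic_B[OF that] eta_gt_1 mult_mono[of 1 "eta P CB" 1 \<eta>] by simp
      then have "1 * (1 / (1 + \<eta>)) \<le> eta P CB * \<eta> * (1 / (1 + \<eta>))"
        using pos by (intro mult_right_mono) auto
      then show ?thesis using R imp by simp
    qed
    then have "certificate_equilibrium P CB (\<pi> CB) (1 - Qd) Qe"
      using R imp pos eta_gt_1
      by (simp add: certificate_equilibrium_def non_binding_def)
    ultimately show ?L
      using R m cut pos
      by (simp add: competitive_equilibrium_iff certificate_equilibria_def dom_cutoff_def)
  }
qed

end


section \<open>The game in export quantities\<close>

locale tic_oligopoly = tic_trade +
  fixes N :: nat
  assumes N_pos: "1 \<le> N"
begin

definition outcome_of :: "(nat \<Rightarrow> real) \<Rightarrow> outcome" where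
  "outcome_of q = (let \<pi> = low_price (\<Sum>n\<in>{1..N}. q n) in
     \<lparr>qdom = (\<lambda>n\<in>{1..N}. dom_cutoff \<pi> / real N), qexp = q, price = \<pi>\<rparr>)"

definition dom_value :: "(country \<Rightarrow> real) \<Rightarrow> real" where
  "dom_value \<pi> = dom_margin \<pi> * dom_cutoff \<pi> - \<delta> * (dom_cutoff \<pi>)\<^sup>2 / 2"

text \<open>This is \<open>N\<close> times a producer's profit under its optimal domestic response;
  \<open>y\<close> is its own export cutoff, \<open>N\<close> times its quantity, whereas
  \<open>Q\<close> is the total quantity.\<close>

definition payoff :: "real \<Rightarrow> real \<Rightarrow> real" where
  "payoff y Q = dom_value (low_price Q) + (exp_margin (low_price Q) * y - \<delta> * y\<^sup>2 / 2)"

lemma scaled_bounds: "x \<in> {0..1 / real N} \<Longrightarrow> 0 \<le> real N * x \<and> real N * x \<le> 1"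
  using N_pos by (auto simp: field_simps)

lemma profit_eq:
  assumes "qd \<in> {0..1 / real N}" "qe \<in> {0..1 / real N}"
  shows "profit w P N \<pi> qd qe = 1 / real N *
     ((dom_margin \<pi> * (real N * qd) - \<delta> * (real N * qd)\<^sup>2 / 2) +
      (exp_margin \<pi> * (real N * qe) - \<delta> * (real N * qe)\<^sup>2 / 2))"
proof -
  note b = scaled_bounds[OF assms(1)] scaled_bounds[OF assms(2)]
  have "(LINT m:{0..real N * qd}|lborel. cost_exp w P \<pi> CB m - cost_dom w CA m)
      = (LINT m:{0..real N * qd}|lborel. dom_margin \<pi> - \<delta> * m)"
    using b by (intro set_lebesgue_integral_cong) (auto simp: dom_gain)
  moreover have "(LINT m:{0..real N * qe}|lborel. cost_dom w CB m - cost_exp w P \<pi> CA m)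
      = (LINT m:{0..real N * qe}|lborel. exp_margin \<pi> - \<delta> * m)"
    using b by (intro set_lebesgue_integral_cong) (auto simp: exp_gain)
  ultimately show ?thesis
    using b by (simp add: profit_def set_integral_affine)
qed

section \<open>Second stage: domestic responses and prices\<close>

lemma dom_cutoff_bounds: "0 \<le> dom_cutoff \<pi>" "dom_cutoff \<pi> \<le> 1"
  by (simp_all add: dom_cutoff_def unit_clamp_bounds)

lemma dom_value_max:
  assumes "0 \<le> x" "x \<le> 1"
  shows "dom_margin \<pi> * x - \<delta> * x\<^sup>2 / 2 + \<delta> * (dom_cutoff \<pi> - x)\<^sup>2 / 2 \<le> dom_value \<pi>"
  using quadratic_max[OF delta_pos assms] by (simp add: dom_value_def dom_cutoff_def)

text \<open>Export profit is the same for every domestic choice and cancels. The squared surplus in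
  \<open>dom_value_max\<close> forces any other optimum to coincide with the clamped vertex.\<close>

lemma best_domestic_response:
  assumes q: "q \<in> {0..1 / real N}"
  shows "(y \<in> {0..1 / real N} \<and>
      (\<forall>x\<in>{0..1 / real N}. profit w P N \<pi> x q \<le> profit w P N \<pi> y q)) \<longleftrightarrow> y = dom_cutoff \<pi> / real N"
    (is "?L \<longleftrightarrow> ?R")
proof -
  let ?y = "dom_cutoff \<pi> / real N"
  have y: "?y \<in> {0..1 / real N}"
    using dom_cutoff_bounds by (auto simp: divide_right_mono)
  have N: "0 < real N" using N_pos by simp
  have le: "profit w P N \<pi> x q + \<delta> * (dom_cutoff \<pi> - real N * x)\<^sup>2 / 2 / real N \<le> profit w P N \<pi> ?y q"
    if x: "x \<in> {0..1 / real N}" for x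
  proof -
    define A where "A = dom_margin \<pi> * (real N * x) - \<delta> * (real N * x)\<^sup>2 / 2"
    define B where "B = exp_margin \<pi> * (real N * q) - \<delta> * (real N * q)\<^sup>2 / 2"
    define S where "S = \<delta> * (dom_cutoff \<pi> - real N * x)\<^sup>2 / 2"
    have "A + S \<le> dom_value \<pi>"
      using dom_value_max[of "real N * x" \<pi>] scaled_bounds[OF x] by (simp add: A_def S_def)
    then have "(A + B + S) / real N \<le> (dom_value \<pi> + B) / real N"
      using N by (intro divide_right_mono) auto
    moreover have "profit w P N \<pi> x q = (A + B) / real N"
      unfolding profit_eq[OF x q] A_def B_def by simp
    moreover have "profit w P N \<pi> ?y q = (dom_value \<pi> + B) / real N"
      unfolding profit_eq[OF y q] B_def dom_value_def using N by simp
    ultimately show ?thesis by (simp add: S_def add_divide_distrib)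
  qed
  show ?thesis
  proof
    assume L: ?L
    with y have "profit w P N \<pi> ?y q \<le> profit w P N \<pi> y q" by blast
    with le L have "\<delta> * (dom_cutoff \<pi> - real N * y)\<^sup>2 / 2 / real N \<le> 0" by fastforce
    then have "(dom_cutoff \<pi> - real N * y)\<^sup>2 \<le> 0"
      using delta_pos N by (simp add: divide_le_0_iff mult_le_0_iff)
    then show ?R using N by (simp add: field_simps)
  next
    assume R: ?R
    have "0 \<le> \<delta> * (dom_cutoff \<pi> - real N * x)\<^sup>2 / 2 / real N" for x
      using delta_pos by simp
    with le y R show ?L by (smt (verit))
  qed
qed

lemma sum_uniform: "(\<Sum>n\<in>{1..N}. c / real N) = c"
  using N_pos by simp

lemma profile_sum:
  assumes "q \<in> quantity_profiles N"
  shows "0 \<le> (\<Sum>n\<in>{1..N}. q n)" "(\<Sum>n\<in>{1..N}. q n) \<le> 1"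
proof -
  have q: "q n \<in> {0..1 / real N}" if "n \<in> {1..N}" for n
    using quantity_profiles_mem[OF assms that] .
  show "0 \<le> (\<Sum>n\<in>{1..N}. q n)" using q by (intro sum_nonneg) auto
  have "(\<Sum>n\<in>{1..N}. q n) \<le> (\<Sum>n\<in>{1..N}. 1 / real N)" using q by (intro sum_mono) auto
  then show "(\<Sum>n\<in>{1..N}. q n) \<le> 1" using N_pos by simp
qed

lemma second_stage_equilibrium_iff:
  assumes q: "q \<in> quantity_profiles N"
  shows "second_stage_equilibrium w P N q s \<longleftrightarrow>
     qexp s = q \<and> qdom s = (\<lambda>n\<in>{1..N}. dom_cutoff (price s) / real N) \<and>
     clears (price s) (\<Sum>n\<in>{1..N}. q n)"
    (is "?L \<longleftrightarrow> ?R")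
proof -
  have qn: "q n \<in> {0..1 / real N}" if "n \<in> {1..N}" for n
    using quantity_profiles_mem[OF q that] .
  have "(qdom s \<in> quantity_profiles N \<and> (\<forall>n\<in>{1..N}. \<forall>x\<in>{0..1 / real N}.
        profit w P N (price s) x (q n) \<le> profit w P N (price s) (qdom s n) (q n))) \<longleftrightarrow>
      (qdom s \<in> extensional {1..N} \<and> (\<forall>n\<in>{1..N}. qdom s n = dom_cutoff (price s) / real N))"
    using best_domestic_response[OF qn]
    unfolding quantity_profiles_def PiE_iff by blast
  also have "\<dots> \<longleftrightarrow> qdom s = (\<lambda>n\<in>{1..N}. dom_cutoff (price s) / real N)"
    by (auto simp: extensional_def restrict_def fun_eq_iff)
  finally have e: "(qdom s \<in> quantity_profiles N \<and> (\<forall>n\<in>{1..N}. \<forall>x\<in>{0..1 / real N}.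
        profit w P N (price s) x (q n) \<le> profit w P N (price s) (qdom s n) (q n))) \<longleftrightarrow>
      qdom s = (\<lambda>n\<in>{1..N}. dom_cutoff (price s) / real N)" .
  have "Qdom N s = dom_cutoff (price s)" if "qdom s = (\<lambda>n\<in>{1..N}. dom_cutoff (price s) / real N)"
    unfolding Qdom_def that using N_pos by simp
  with e show ?thesis
    unfolding second_stage_equilibrium_def clears_def Qexp_def by metis
qed

text \<open>\<open>low_price\<close> clears the markets and lies componentwise below every clearing
  price, so it is the selected price vector; prices in turn determine domestic quantities.\<close>

lemma second_stage_outcome_iff:
  assumes q: "q \<in> quantity_profiles N"
  shows "second_stage_outcome w P N q s \<longleftrightarrow> supportable (\<Sum>n\<in>{1..N}. q n) \<and> s = outcome_of q"
    (is "_ \<longleftrightarrow> supportable ?Q \<and> _")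
proof
  note Q = profile_sum[OF q]
  assume s: "second_stage_outcome w P N q s"
  then have eq: "second_stage_equilibrium w P N q s"
    and low: "\<And>t i. second_stage_equilibrium w P N q t \<Longrightarrow> price s i \<le> price t i"
    by (auto simp: second_stage_outcome_def)
  then have c: "clears (price s) ?Q" by (simp add: second_stage_equilibrium_iff[OF q])
  then have sup: "supportable ?Q" and ge: "\<And>i. low_price ?Q i \<le> price s i"
    using clears_lower_bound Q by blast+
  have "second_stage_equilibrium w P N q (outcome_of q)"
    using clears_low_price[OF sup Q]
    by (simp add: second_stage_equilibrium_iff[OF q] outcome_of_def Let_def)
  from low[OF this] ge have "price s i = low_price ?Q i" for i
    by (intro antisym) (simp_all add: outcome_of_def Let_def)
  then have "price s = low_price ?Q" by auto
  then have "s = outcome_of q"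
    using eq by (intro outcome_eqI) (simp_all add: second_stage_equilibrium_iff[OF q] outcome_of_def Let_def)
  with sup show "supportable ?Q \<and> s = outcome_of q" ..
next
  note Q = profile_sum[OF q]
  assume s: "supportable ?Q \<and> s = outcome_of q"
  then have "second_stage_equilibrium w P N q s"
    using clears_low_price Q
    by (simp add: second_stage_equilibrium_iff[OF q] outcome_of_def Let_def)
  moreover have "price s i \<le> price t i" if "second_stage_equilibrium w P N q t" for t i
    using s that clears_lower_bound(2)[of "price t" ?Q i] Q
    by (simp add: second_stage_equilibrium_iff[OF q] outcome_of_def Let_def)
  ultimately show "second_stage_outcome w P N q s" by (simp add: second_stage_outcome_def)
qed

section \<open>Reduction to export quantities\<close>

lemma profit_outcome_of:
  assumes q: "q \<in> quantity_profiles N" and n: "n \<in> {1..N}"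
  shows "profit w P N (price (outcome_of q)) (qdom (outcome_of q) n) (q n)
     = payoff (real N * q n) (\<Sum>k\<in>{1..N}. q k) / real N"
proof -
  have "q n \<in> {0..1 / real N}"
    using quantity_profiles_mem[OF q n] .
  moreover have "qdom (outcome_of q) n = dom_cutoff (price (outcome_of q)) / real N"
    using n by (simp add: outcome_of_def Let_def)
  moreover have "dom_cutoff \<pi> / real N \<in> {0..1 / real N}" for \<pi>
    using dom_cutoff_bounds by (auto simp: divide_right_mono)
  ultimately show ?thesis
    using N_pos by (simp add: profit_eq payoff_def dom_value_def outcome_of_def Let_def)
qed

text \<open>A deviation of producer \<open>n\<close> to \<open>x\<close> moves total exports to the
  old sum minus \<open>q n\<close> plus \<open>x\<close>. Deviations to an unsupportable total have
  no second-stage outcome, so they impose no condition.\<close>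

definition reduced_nash :: "(nat \<Rightarrow> real) \<Rightarrow> bool" where
  "reduced_nash q \<longleftrightarrow> q \<in> quantity_profiles N \<and> supportable (\<Sum>k\<in>{1..N}. q k) \<and>
     (\<forall>n\<in>{1..N}. \<forall>x\<in>{0..1 / real N}.
        supportable ((\<Sum>k\<in>{1..N}. q k) - q n + x) \<longrightarrow>
        payoff (real N * x) ((\<Sum>k\<in>{1..N}. q k) - q n + x)
          \<le> payoff (real N * q n) (\<Sum>k\<in>{1..N}. q k))"

lemma sum_update:
  fixes q :: "nat \<Rightarrow> real"
  assumes "n \<in> {1..N}"
  shows "(\<Sum>k\<in>{1..N}. (q(n := x)) k) = (\<Sum>k\<in>{1..N}. q k) - q n + x"
proof -
  have "(\<Sum>k\<in>{1..N} - {n}. (q(n := x)) k) = (\<Sum>k\<in>{1..N} - {n}. q k)"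
    by (intro sum.cong) auto
  then show ?thesis
    using sum.remove[OF _ assms, of "q(n := x)"] sum.remove[OF _ assms, of q] by simp
qed

text \<open>Each export profile has at most one second-stage outcome, so the quantifier over
  outcomes after a deviation collapses to a support condition.\<close>

lemma nash_iff: "nash_equilibrium w P N s \<longleftrightarrow> (\<exists>q. reduced_nash q \<and> s = outcome_of q)"
proof -
  have N: "0 < real N" using N_pos by simp
  have main: "nash_equilibrium w P N (outcome_of q) \<longleftrightarrow> reduced_nash q" for q
  proof (cases "q \<in> quantity_profiles N")
    case q: True
    have upd: "q(n := x) \<in> quantity_profiles N" if "n \<in> {1..N}" "x \<in> {0..1 / real N}" for n x
      using q that by (auto simp: quantity_profiles_def PiE_iff extensional_def)
    have "(\<forall>t. second_stage_outcome w P N (q(n := x)) t \<longrightarrow>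
          profit w P N (price t) (qdom t n) x \<le>
          profit w P N (price (outcome_of q)) (qdom (outcome_of q) n) (q n)) \<longleftrightarrow>
        (supportable ((\<Sum>k\<in>{1..N}. q k) - q n + x) \<longrightarrow>
        payoff (real N * x) ((\<Sum>k\<in>{1..N}. q k) - q n + x)
          \<le> payoff (real N * q n) (\<Sum>k\<in>{1..N}. q k))"
      if n: "n \<in> {1..N}" and x: "x \<in> {0..1 / real N}" for n x
      using profit_outcome_of[OF upd[OF n x] n] N
      unfolding second_stage_outcome_iff[OF upd[OF n x]] sum_update[OF n] profit_outcome_of[OF q n]
      by (auto simp: divide_le_cancel)
    moreover have "qexp (outcome_of q) = q" by (simp add: outcome_of_def Let_def)
    ultimately show ?thesis
      unfolding nash_equilibrium_def reduced_nash_def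
      using q second_stage_outcome_iff[OF q, of "outcome_of q"] by auto
  next
    case False
    then show ?thesis by (simp add: nash_equilibrium_def reduced_nash_def outcome_of_def Let_def)
  qed
  have "s = outcome_of (qexp s)" if "nash_equilibrium w P N s"
    using that second_stage_outcome_iff unfolding nash_equilibrium_def by blast
  with main show ?thesis by metis
qed

section \<open>Payoffs in the two price regimes\<close>

lemma dom_value_mono:
  assumes "dom_margin \<pi> \<le> dom_margin \<pi>'"
  shows "dom_value \<pi> \<le> dom_value \<pi>'"
proof -
  let ?D = "dom_cutoff \<pi>"
  have "dom_margin \<pi> * ?D \<le> dom_margin \<pi>' * ?D"
    using assms dom_cutoff_bounds by (intro mult_right_mono) auto
  \<comment> \<open>The old cutoff stays available at the higher margin and earns more there
    already.\<close>
  moreover have "dom_margin \<pi>' * ?D - \<delta> * ?D\<^sup>2 / 2 + \<delta> * (dom_cutoff \<pi>' - ?D)\<^sup>2 / 2 \<le> dom_value \<pi>'"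
    using dom_cutoff_bounds by (intro dom_value_max) auto
  moreover have "0 \<le> \<delta> * (dom_cutoff \<pi>' - ?D)\<^sup>2 / 2" using delta_pos by simp
  ultimately show ?thesis unfolding dom_value_def[of \<pi>] by linarith
qed

text \<open>\<open>G\<close> is the total export quantity of the other producers.\<close>

definition rival_payoff :: "real \<Rightarrow> real \<Rightarrow> real" where
  "rival_payoff G y = (1 - \<eta> * (G + y / real N))\<^sup>2 / 2 + (1 - \<eta> * (G + y / real N)) * y - y\<^sup>2 / 2"

text \<open>The domestic cutoff and both margins divided by \<delta> are the same number
  \<open>K\<close>, so the domestic value is \<open>\<delta> * K\<^sup>2 / 2\<close>.\<close>

lemma payoff_low_export:
  assumes "0 \<le> G + y / real N" "\<alpha> \<le> \<delta> * (1 - \<eta> * (G + y / real N))"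
  shows "payoff y (G + y / real N) = \<delta> * rival_payoff G y"
proof -
  define K where "K = 1 - \<eta> * (G + y / real N)"
  have "dom_margin (low_price (G + y / real N)) = \<delta> * K"
    "exp_margin (low_price (G + y / real N)) = \<delta> * K"
    "dom_cutoff (low_price (G + y / real N)) = K"
    using low_export[OF assms] by (simp_all add: K_def dom_margin_def exp_margin_def)
  then show ?thesis
    by (simp add: payoff_def dom_value_def rival_payoff_def flip: K_def)
      (simp add: power2_eq_square field_simps)
qed

text \<open>At a zero price in A neither margin exceeds \<alpha>, so each of the two markets
  contributes at most the vertex value \<open>\<alpha>\<^sup>2 / (2 * \<delta>)\<close>.\<close>

lemma payoff_high_export:
  assumes "0 \<le> Q" "Q \<le> 1" "supportable Q" "\<delta> * (1 - \<eta> * Q) \<le> \<alpha>" "0 \<le> y"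
  shows "payoff y Q \<le> \<alpha>\<^sup>2 / \<delta>"
proof -
  let ?\<pi> = "low_price Q" and ?D = "dom_cutoff (low_price Q)"
  have c: "clears ?\<pi> Q" using assms by (intro clears_low_price) auto
  have A: "?\<pi> CA = 0" using assms by (simp add: low_price_def)
  have "dom_margin ?\<pi> \<le> \<alpha>" using A clears_transfer_nonneg[OF c] by (simp add: dom_margin_def)
  then have "dom_margin ?\<pi> * ?D \<le> \<alpha> * ?D" using dom_cutoff_bounds by (intro mult_right_mono) auto
  then have "dom_value ?\<pi> \<le> \<alpha> * ?D - \<delta> * ?D\<^sup>2 / 2" unfolding dom_value_def by (rule diff_right_mono)
  also have "\<dots> \<le> \<alpha>\<^sup>2 / (2 * \<delta>)" by (rule quadratic_le_vertex[OF delta_pos])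
  finally have dom: "dom_value ?\<pi> \<le> \<alpha>\<^sup>2 / (2 * \<delta>)" .
  have "exp_margin ?\<pi> \<le> \<alpha>" using A clears_nonneg[OF c] by (simp add: exp_margin_def)
  then have "exp_margin ?\<pi> * y \<le> \<alpha> * y" using assms by (intro mult_right_mono) auto
  then have "exp_margin ?\<pi> * y - \<delta> * y\<^sup>2 / 2 \<le> \<alpha> * y - \<delta> * y\<^sup>2 / 2" by (rule diff_right_mono)
  also have "\<dots> \<le> \<alpha>\<^sup>2 / (2 * \<delta>)" by (rule quadratic_le_vertex[OF delta_pos])
  finally have "payoff y Q \<le> \<alpha>\<^sup>2 / (2 * \<delta>) + \<alpha>\<^sup>2 / (2 * \<delta>)"
    unfolding payoff_def using dom by (rule add_mono[rotated])
  also have "\<dots> = \<alpha>\<^sup>2 / \<delta>"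
    using field_sum_of_halves[of "\<alpha>\<^sup>2 / \<delta>"] by (simp only: divide_divide_eq_left mult.commute)
  finally show ?thesis .
qed

section \<open>Necessary conditions for equilibrium\<close>

lemma rival_payoff_deriv:
  "(rival_payoff G has_real_derivative
     (1 - \<eta> * (G + y / real N)) * (1 - \<eta> / real N) - (1 + \<eta> / real N) * y) (at y)"
proof -
  define e where "e = \<eta> / real N"
  have e: "\<eta> * (G + z / real N) = \<eta> * G + e * z" for z
    by (simp add: e_def distrib_left)
  show ?thesis
    unfolding rival_payoff_def e e_def[symmetric]
    by (auto intro!: derivative_eq_intros simp: field_simps)
qed

text \<open>This number is total exports and also the common export cutoff, because each producer
  exports the fraction \<open>1 / N\<close> of it.\<close>

definition symmetric_export :: real where
  "symmetric_export = (if real N > \<eta>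
     then (real N - \<eta>) / (real N * (\<eta> + 1) - \<eta> * (\<eta> - 1)) else 0)"

lemma reduced_nash_low_export:
  assumes ne: "reduced_nash q"
  shows "\<alpha> < \<delta> * (1 - \<eta> * (\<Sum>k\<in>{1..N}. q k))"
proof (rule ccontr)
  define Q where "Q = (\<Sum>k\<in>{1..N}. q k)"
  assume "\<not> ?thesis"
  then have high: "\<delta> * (1 - \<eta> * Q) \<le> \<alpha>" by (simp add: Q_def)
  have q: "q \<in> quantity_profiles N" and sup: "supportable Q"
    using ne by (auto simp: reduced_nash_def Q_def)
  have Q: "0 \<le> Q" "Q \<le> 1" using profile_sum[OF q] by (auto simp: Q_def)
  have qn: "q n \<in> {0..1 / real N}" if "n \<in> {1..N}" for n
    using quantity_profiles_mem[OF q that] .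
  have N: "0 < real N" using N_pos by simp
  define a where "a = \<alpha> / \<delta>"
  have a: "0 < a" "a \<le> 1" "\<delta> * a = \<alpha>" using alpha_pos alpha_le_beta by (auto simp: a_def)
  \<comment> \<open>If all cutoffs were at most \<open>a\<close>, total exports would be too, and
    \<open>alpha_small\<close> would make A's price positive.\<close>
  have "\<exists>n\<in>{1..N}. a / real N < q n"
  proof (rule ccontr)
    assume "\<not> ?thesis"
    then have "Q \<le> (\<Sum>k\<in>{1..N}. a / real N)"
      unfolding Q_def by (intro sum_mono) (auto simp: not_less)
    then have "Q \<le> a" by (simp only: sum_uniform)
    then have "\<delta> * (\<eta> * Q) \<le> \<delta> * (\<eta> * a)"
      using delta_pos eta_gt_1 by (intro mult_left_mono) auto
    also have "\<dots> = \<eta> * \<alpha>" using a(3) by (simp only: mult.left_commute)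
    finally show False using high alpha_small by (simp add: algebra_simps)
  qed
  then obtain n where n: "n \<in> {1..N}" and big: "a / real N < q n" by blast
  define x where "x = a / real N"
  define y where "y = real N * q n"
  define Q' where "Q' = Q - q n + x"
  have Nx: "real N * x = a" using N by (simp add: x_def)
  have x: "x \<in> {0..1 / real N}" using a N by (auto simp: x_def divide_right_mono)
  have y: "a < y" using big N by (simp add: y_def field_simps)
  have "q n \<le> Q" unfolding Q_def using qn n by (intro member_le_sum) auto
  then have Q': "0 \<le> Q'" "Q' \<le> Q" using x big by (auto simp: Q'_def x_def)
  \<comment> \<open>Cutting back to \<open>a\<close> keeps the total supportable and weakly raises
    both margins, so the price effect cannot hurt the deviating producer.\<close>
  note mono = low_price_mono[OF sup Q'(2)]
  have dev: "payoff a Q' \<le> payoff y Q"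
    using ne n x mono(1) Nx unfolding reduced_nash_def Q'_def Q_def y_def by metis
  have "dom_value (low_price Q) \<le> dom_value (low_price Q')"
    using mono Q'(1) by (intro dom_value_mono) (auto simp: dom_margin_def)
  moreover have L: "exp_margin (low_price Q) \<le> exp_margin (low_price Q')"
    using mono Q'(1) by (auto simp: exp_margin_def)
  then have "exp_margin (low_price Q) * a \<le> exp_margin (low_price Q') * a"
    using a by (intro mult_right_mono) auto
  moreover have "exp_margin (low_price Q) \<le> \<alpha>"
    using high clears_nonneg[OF clears_low_price[OF sup Q]]
    by (simp add: exp_margin_def low_price_def)
  \<comment> \<open>At fixed prices, moving the cutoff from \<open>y\<close> to \<open>a\<close>
    gains \<open>y - a\<close> times the excess of \<open>\<delta> * (y + a) / 2\<close> over the
    export margin; that margin is at most \<alpha>.\<close>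
  moreover have "\<alpha> < \<delta> * (y + a) / 2"
  proof -
    have "\<alpha> < \<delta> * y" using mult_strict_left_mono[OF y delta_pos] unfolding a(3) .
    moreover have "\<delta> * (y + a) / 2 = (\<delta> * y + \<alpha>) / 2" by (simp only: distrib_left a(3))
    ultimately show ?thesis by simp
  qed
  ultimately have "0 < (y - a) * (\<delta> * (y + a) / 2 - exp_margin (low_price Q))"
    using y by simp
  also have "\<dots> = (exp_margin (low_price Q) * a - \<delta> * a\<^sup>2 / 2) - (exp_margin (low_price Q) * y - \<delta> * y\<^sup>2 / 2)"
    by (simp add: power2_eq_square field_simps)
  finally show False
    using dev \<open>dom_value (low_price Q) \<le> _\<close> \<open>exp_margin (low_price Q) * a \<le> _\<close>
    unfolding payoff_def by linarith
qed

text \<open>A's price is positive in equilibrium, so small deviations stay where the payoff is a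
  multiple of \<open>rival_payoff\<close>. Its derivative \<open>d\<close> must have the sign of an
  optimum on the unit interval, one-sided at the corners.\<close>

lemma reduced_nash_first_order:
  assumes ne: "reduced_nash q" and n: "n \<in> {1..N}"
  defines "Q \<equiv> (\<Sum>k\<in>{1..N}. q k)" and "y \<equiv> real N * q n"
  defines "d \<equiv> (1 - \<eta> * Q) * (1 - \<eta> / real N) - (1 + \<eta> / real N) * y"
  shows "y < 1 \<Longrightarrow> d \<le> 0" "0 < y \<Longrightarrow> 0 \<le> d"
proof -
  have N: "0 < real N" using N_pos by simp
  have q: "q \<in> quantity_profiles N" using ne by (auto simp: reduced_nash_def)
  have qn: "q k \<in> {0..1 / real N}" if "k \<in> {1..N}" for k
    using quantity_profiles_mem[OF q that] .
  define G where "G = Q - q n"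
  have G: "0 \<le> G" unfolding G_def Q_def using member_le_sum[of n "{1..N}" q] qn n by auto
  have Qe: "Q = G + y / real N" using N by (simp add: G_def y_def)
  have low: "\<alpha> < \<delta> * (1 - \<eta> * Q)" using reduced_nash_low_export[OF ne] by (simp add: Q_def)
  have y: "0 \<le> y" "y \<le> 1" using scaled_bounds[OF qn[OF n]] by (auto simp: y_def)
  have opt: "rival_payoff G z \<le> rival_payoff G y"
    if z: "0 \<le> z" "z \<le> 1" "\<alpha> \<le> \<delta> * (1 - \<eta> * (G + z / real N))" for z
  proof -
    have zN: "z / real N \<in> {0..1 / real N}" using z by (auto simp: divide_right_mono)
    have pos: "0 \<le> G + z / real N" using G z by simp
    have "payoff (real N * (z / real N)) (Q - q n + z / real N) \<le> payoff (real N * q n) Q"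
      using ne n zN low_export(1)[OF pos z(3)]
      unfolding reduced_nash_def Q_def G_def by blast
    then have "payoff z (G + z / real N) \<le> payoff y (G + y / real N)"
      using N Qe unfolding G_def y_def by simp
    moreover have "payoff z (G + z / real N) = \<delta> * rival_payoff G z"
      using z pos by (intro payoff_low_export) auto
    moreover have "payoff y (G + y / real N) = \<delta> * rival_payoff G y"
      using low Qe G y by (intro payoff_low_export) auto
    ultimately show ?thesis using delta_pos by simp
  qed
  have der: "(rival_payoff G has_real_derivative d) (at y)"
    using rival_payoff_deriv[of G y] unfolding d_def Qe .
  show "d \<le> 0" if "y < 1"
  proof (rule ccontr)
    assume "\<not> d \<le> 0"
    then obtain r where r: "0 < r" "\<And>h. 0 < h \<Longrightarrow> h < r \<Longrightarrow> rival_payoff G y < rival_payoff G (y + h)"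
      using DERIV_pos_inc_right[OF der] by auto
    \<comment> \<open>The increase of the cutoff that brings A's price exactly down to zero: a step
      \<open>s\<close> adds \<open>s / real N\<close> to total exports.\<close>
    define s where "s = (\<delta> * (1 - \<eta> * Q) - \<alpha>) * real N / (\<delta> * \<eta>)"
    have s: "0 < s" using low N delta_pos eta_gt_1 by (auto simp: s_def intro!: divide_pos_pos mult_pos_pos)
    define h where "h = min (r / 2) (min s (1 - y))"
    have h: "0 < h" "h < r" "h \<le> s" "h \<le> 1 - y" using r s that by (auto simp: h_def)
    have "h * (\<delta> * \<eta> / real N) \<le> s * (\<delta> * \<eta> / real N)"
      using h delta_pos eta_gt_1 by (intro mult_right_mono) auto
    also have "\<dots> = \<delta> * (1 - \<eta> * Q) - \<alpha>" using N delta_pos eta_gt_1 by (simp add: s_def)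
    finally have "\<alpha> \<le> \<delta> * (1 - \<eta> * Q) - h * (\<delta> * \<eta> / real N)" by simp
    also have "\<dots> = \<delta> * (1 - \<eta> * (G + (y + h) / real N))"
      unfolding Qe using N by (simp add: field_simps)
    finally have "rival_payoff G (y + h) \<le> rival_payoff G y" using y h by (intro opt) auto
    with r(2)[OF h(1,2)] show False by simp
  qed
  show "0 \<le> d" if "0 < y"
  proof (rule ccontr)
    assume "\<not> 0 \<le> d"
    then obtain r where r: "0 < r" "\<And>h. 0 < h \<Longrightarrow> h < r \<Longrightarrow> rival_payoff G y < rival_payoff G (y - h)"
      using DERIV_neg_dec_left[OF der] by auto
    define h where "h = min (r / 2) y"
    have h: "0 < h" "h < r" "h \<le> y" using r that by (auto simp: h_def)
    \<comment> \<open>Smaller exports raise A's price, so downward deviations always satisfy the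
      price condition of \<open>opt\<close>.\<close>
    have "G + (y - h) / real N \<le> Q" unfolding Qe using h N by (simp add: divide_right_mono)
    then have "\<delta> * (1 - \<eta> * Q) \<le> \<delta> * (1 - \<eta> * (G + (y - h) / real N))"
      using delta_pos eta_gt_1 by (intro mult_left_mono) auto
    then have "rival_payoff G (y - h) \<le> rival_payoff G y" using y h low by (intro opt) auto
    with r(2)[OF h(1,2)] show False by simp
  qed
qed

text \<open>Exports stay below the competitive quantity: for \<open>\<eta> < real N\<close> the
  denominator exceeds \<open>(1 + \<eta>) * (real N - \<eta>)\<close> by \<open>2 * \<eta>\<close>.
  Then \<open>1 - \<eta> * symmetric_export\<close> exceeds \<open>1 / (1 + \<eta>)\<close> and
  hence \<open>\<alpha> / \<delta>\<close>.\<close>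

lemma symmetric_export_bounds:
  "0 \<le> symmetric_export" "(1 + \<eta>) * symmetric_export < 1"
  "\<alpha> < \<delta> * (1 - \<eta> * symmetric_export)"
proof -
  have den: "2 * \<eta> < real N * (\<eta> + 1) - \<eta> * (\<eta> - 1)" if "\<eta> < real N"
    using mult_strict_right_mono[OF that, of "\<eta> + 1"] eta_gt_1 by (simp add: algebra_simps)
  show "0 \<le> symmetric_export" using den eta_gt_1 by (auto simp: symmetric_export_def)
  show s: "(1 + \<eta>) * symmetric_export < 1"
  proof (cases "\<eta> < real N")
    case True
    have "(1 + \<eta>) * (real N - \<eta>) < real N * (\<eta> + 1) - \<eta> * (\<eta> - 1)"
      using eta_gt_1 by (simp add: algebra_simps)
    then show ?thesis
      using True den[OF True] eta_gt_1 by (simp add: symmetric_export_def del: right_diff_distrib_numeral)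
  qed (simp add: symmetric_export_def)
  have "\<eta> * ((1 + \<eta>) * symmetric_export) < \<eta>" using s eta_gt_1 by simp
  then have "1 < (1 - \<eta> * symmetric_export) * (1 + \<eta>)" by (simp add: algebra_simps)
  then have "\<delta> * 1 < \<delta> * ((1 - \<eta> * symmetric_export) * (1 + \<eta>))"
    using delta_pos by (intro mult_strict_left_mono) auto
  with alpha_small have "\<alpha> * (1 + \<eta>) < \<delta> * (1 - \<eta> * symmetric_export) * (1 + \<eta>)" by simp
  then show "\<alpha> < \<delta> * (1 - \<eta> * symmetric_export)" using eta_gt_1 by (simp only: mult_less_cancel_right)
qed

text \<open>This is the zero of the derivative of \<open>rival_payoff\<close> at which own cutoff
  and total exports both equal \<open>symmetric_export\<close>.\<close>

lemma symmetric_export_first_order: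
  assumes "\<eta> < real N"
  shows "(1 - \<eta> * symmetric_export) * (1 - \<eta> / real N) = (1 + \<eta> / real N) * symmetric_export"
proof -
  have "2 * \<eta> < real N * (\<eta> + 1) - \<eta> * (\<eta> - 1)"
    using mult_strict_right_mono[OF assms, of "\<eta> + 1"] eta_gt_1 by (simp add: algebra_simps)
  then have "symmetric_export * (real N * (\<eta> + 1) - \<eta> * (\<eta> - 1)) = real N - \<eta>"
    using assms eta_gt_1 by (simp add: symmetric_export_def)
  then show ?thesis using N_pos by (simp add: field_simps)
qed

text \<open>For \<open>\<eta> < real N\<close> both corners are excluded, and the interior condition
  gives every producer a cutoff depending only on \<open>Q\<close>; summation leaves one linear
  equation for \<open>Q\<close>. For \<open>1 \<le> e\<close> the derivative is negative at every
  positive cutoff.\<close>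

lemma reduced_nash_unique:
  assumes ne: "reduced_nash q"
  shows "q = (\<lambda>n\<in>{1..N}. symmetric_export / real N)"
proof -
  have N: "0 < real N" using N_pos by simp
  define Q where "Q = (\<Sum>k\<in>{1..N}. q k)"
  define e where "e = \<eta> / real N"
  have e: "0 < e" using N eta_gt_1 by (simp add: e_def)
  have q: "q \<in> quantity_profiles N" using ne by (auto simp: reduced_nash_def)
  have qn: "q k \<in> {0..1 / real N}" if "k \<in> {1..N}" for k
    using quantity_profiles_mem[OF q that] .
  have Q: "0 \<le> Q" using profile_sum[OF q] by (simp add: Q_def)
  have "0 < \<delta> * (1 - \<eta> * Q)" using reduced_nash_low_export[OF ne] alpha_pos by (simp add: Q_def)
  then have K: "0 < 1 - \<eta> * Q" using delta_pos by (simp add: zero_less_mult_iff)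
  have K1: "1 - \<eta> * Q \<le> 1" using Q eta_gt_1 by simp
  have foc: "(real N * q n < 1 \<longrightarrow> (1 - \<eta> * Q) * (1 - e) - (1 + e) * (real N * q n) \<le> 0) \<and>
      (0 < real N * q n \<longrightarrow> 0 \<le> (1 - \<eta> * Q) * (1 - e) - (1 + e) * (real N * q n))"
    if "n \<in> {1..N}" for n
    using reduced_nash_first_order[OF ne that] unfolding Q_def e_def by blast
  have val: "real N * q n = symmetric_export" if n: "n \<in> {1..N}" for n
  proof (cases "\<eta> < real N")
    case True
    then have e1: "e < 1" using N by (simp add: e_def)
    have each: "real N * q k = (1 - \<eta> * Q) * (1 - e) / (1 + e)" if k: "k \<in> {1..N}" for k
    proof -
      define y where "y = real N * q k"
      have y: "0 \<le> y" "y \<le> 1" using scaled_bounds[OF qn[OF k]] by (auto simp: y_def)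
      note foc = foc[OF k, folded y_def]
      have p: "0 < (1 - \<eta> * Q) * (1 - e)" using K e1 by simp
      have "(1 - \<eta> * Q) * (1 - e) \<le> 1 * (1 - e)" using K1 e1 by (intro mult_right_mono) auto
      \<comment> \<open>At \<open>y = 1\<close> the derivative is at most
        \<open>(1 - e) - (1 + e)\<close>, which is negative; at \<open>y = 0\<close> it is
        positive.\<close>
      then have "y \<noteq> 1" using foc e by auto
      moreover have "y \<noteq> 0" using foc p by auto
      ultimately have "(1 - \<eta> * Q) * (1 - e) - (1 + e) * y = 0"
        using foc y by linarith
      then show ?thesis unfolding y_def[symmetric] using e by (simp add: nonzero_eq_divide_eq mult.commute)
    qed
    define c where "c = (1 - \<eta> * Q) * (1 - e) / (1 + e)"
    have "q k = c / real N" if "k \<in> {1..N}" for k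
      using each[OF that, folded c_def] N by (simp add: nonzero_eq_divide_eq mult.commute)
    then have "Q = (\<Sum>k\<in>{1..N}. c / real N)" unfolding Q_def by (intro sum.cong) auto
    then have Qc: "Q = (1 - \<eta> * Q) * (1 - e) / (1 + e)" by (simp only: sum_uniform c_def)
    then have "Q * (1 + e) = (1 - \<eta> * Q) * (1 - e)" using e by (simp add: nonzero_eq_divide_eq)
    moreover have "symmetric_export * (1 + e) = (1 - \<eta> * symmetric_export) * (1 - e)"
      using symmetric_export_first_order[OF True] by (simp add: e_def mult.commute)
    ultimately have "(Q - symmetric_export) * ((1 + e) + \<eta> * (1 - e)) = 0"
      by (simp add: algebra_simps)
    moreover have "0 < (1 + e) + \<eta> * (1 - e)" using e e1 eta_gt_1 by (simp add: add_pos_pos)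
    ultimately have "Q = symmetric_export" by simp
    with Qc each[OF n] show ?thesis by simp
  next
    case False
    then have e1: "1 \<le> e" using N by (simp add: e_def)
    have "\<not> 0 < real N * q n"
    proof
      assume pos: "0 < real N * q n"
      have "(1 - \<eta> * Q) * (1 - e) \<le> 0" using K e1 by (simp add: mult_nonneg_nonpos)
      moreover have "0 < (1 + e) * (real N * q n)" using mult_pos_pos[OF _ pos, of "1 + e"] e by linarith
      ultimately show False using foc[OF n] pos by linarith
    qed
    then show ?thesis using False scaled_bounds[OF qn[OF n]] by (simp add: symmetric_export_def)
  qed
  show ?thesis
  proof
    fix n
    show "q n = (\<lambda>n\<in>{1..N}. symmetric_export / real N) n"
    proof (cases "n \<in> {1..N}")
      case True
      then show ?thesis using val[OF True] N by (simp add: nonzero_eq_divide_eq mult.commute)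
    next
      case False
      then show ?thesis using q by (auto simp: quantity_profiles_def PiE_def extensional_def)
    qed
  qed
qed

section \<open>Existence of equilibrium\<close>

lemma rival_payoff_max:
  assumes "0 \<le> y" "y \<le> 1"
    and low: "\<alpha> \<le> \<delta> * (1 - \<eta> * (symmetric_export - symmetric_export / real N + y / real N))"
  shows "rival_payoff (symmetric_export - symmetric_export / real N) y
    \<le> rival_payoff (symmetric_export - symmetric_export / real N) symmetric_export"
proof -
  have N: "0 < real N" using N_pos by simp
  define e where "e = \<eta> / real N"
  have e: "0 < e" using N eta_gt_1 by (simp add: e_def)
  define s where "s = symmetric_export"
  define G where "G = s - s / real N"
  have "rival_payoff G z = (1 - \<eta> * G - e * z)\<^sup>2 / 2 + (1 - \<eta> * G - e * z) * z - z\<^sup>2 / 2" for z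
    by (simp add: rival_payoff_def e_def algebra_simps)
  note f = this
  show ?thesis
  proof (cases "\<eta> < real N")
    case True
    then have e1: "e < 1" using N by (simp add: e_def)
    have foc: "(1 - \<eta> * s) * (1 - e) = (1 + e) * s"
      using symmetric_export_first_order[OF True] by (simp add: s_def e_def)
    have k: "1 - \<eta> * G = (1 - \<eta> * s) + e * s" by (simp add: G_def e_def algebra_simps)
    \<comment> \<open>Exact expansion of the quadratic around \<open>s\<close>: the linear
      coefficient vanishes by \<open>foc\<close>, and \<open>e < 1\<close> makes the quadratic term
      non-positive.\<close>
    have "rival_payoff G y - rival_payoff G s
        = (y - s) * ((1 - \<eta> * s) * (1 - e) - (1 + e) * s) - (1 + e * (2 - e)) * (y - s)\<^sup>2 / 2"
      unfolding f k by (simp add: power2_eq_square field_simps)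
    also have "\<dots> = - ((1 + e * (2 - e)) * (y - s)\<^sup>2 / 2)" by (simp add: foc)
    also have "\<dots> \<le> 0" using e e1 by simp
    finally show ?thesis by (simp add: G_def s_def)
  next
    case False
    then have s0: "s = 0" by (simp add: s_def symmetric_export_def)
    then have G0: "G = 0" by (simp add: G_def)
    have e1: "1 \<le> e" using False N by (simp add: e_def)
    have "0 < \<delta> * (1 - e * y)"
      using low alpha_pos s0 by (simp add: s_def e_def)
    then have ey: "e * y < 1" using delta_pos by (simp add: zero_less_mult_iff)
    have ey0: "0 \<le> e * y" using e assms by simp
    \<comment> \<open>For large \<open>e\<close> the quadratic is convex in \<open>y\<close>, so a
      local argument fails. The bound \<open>e * y < 1\<close>, obtained from \<open>low\<close>,
      controls the only summand that can be positive.\<close>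
    have "rival_payoff G y - rival_payoff G s = y * ((1 - e) + (e * y) * (e - 2) / 2 - y / 2)"
      unfolding f unfolding s0 G0 by (simp add: power2_eq_square field_simps)
    also have "\<dots> \<le> 0"
    proof -
      have "(e * y) * (e - 2) / 2 \<le> e - 1"
      proof (cases "2 \<le> e")
        case True
        then have "(e * y) * (e - 2) \<le> 1 * (e - 2)" using ey by (intro mult_right_mono) auto
        then have "(e * y) * (e - 2) / 2 \<le> (e - 2) / 2" by simp
        also have "\<dots> \<le> e - 1" using True by simp
        finally show ?thesis .
      next
        case False
        then have "(e * y) * (e - 2) \<le> 0" using ey0 by (simp add: mult_nonneg_nonpos)
        then show ?thesis using e1 by linarith
      qed
      then show ?thesis using assms by (intro mult_nonneg_nonpos) auto
    qed
    finally show ?thesis by (simp add: G_def s_def)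
  qed
qed

text \<open>Deviations that keep A's price formula non-negative lose by
  \<open>rival_payoff_max\<close>. Deviations beyond that point earn at most
  \<open>\<alpha>\<^sup>2 / \<delta>\<close>, which \<open>floor\<close> shows to be no more than
  the equilibrium payoff.\<close>

lemma reduced_nash_symmetric: "reduced_nash (\<lambda>n\<in>{1..N}. symmetric_export / real N)"
proof -
  have N: "0 < real N" and N1: "1 \<le> real N" using N_pos by auto
  define s where "s = symmetric_export"
  define u where "u = 1 / real N"
  define G where "G = s - s / real N"
  define q where "q = (\<lambda>n\<in>{1..N}. s / real N)"
  note s = symmetric_export_bounds[folded s_def]
  have s1: "s \<le> 1" using s eta_gt_1 mult_right_mono[of 1 "1 + \<eta>" s] by simp
  have u: "0 < u" "u \<le> 1" using N N1 by (auto simp: u_def)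
  have Gu: "G = (1 - u) * s" by (simp add: G_def u_def algebra_simps)
  then have G: "0 \<le> G" using u s by simp
  have qQ: "(\<Sum>k\<in>{1..N}. q k) = s" using N by (simp add: q_def)
  have qp: "q \<in> quantity_profiles N"
    using s s1 by (auto simp: q_def quantity_profiles_def divide_right_mono)
  have sG: "G + s / real N = s" by (simp add: G_def)
  have pay_s: "payoff s s = \<delta> * rival_payoff G s"
    using payoff_low_export[of G s] s by (simp add: sG)
  define a where "a = \<alpha> / \<delta>"
  have a: "0 < a" "a \<le> 1" "\<delta> * a = \<alpha>" using alpha_pos alpha_le_beta by (auto simp: a_def)
  have a_small: "(1 + \<eta>) * a < 1"
    using alpha_small delta_pos by (simp add: a_def field_simps)
  \<comment> \<open>Exporting up to the cutoff \<open>\<alpha> / \<delta>\<close> keeps A's price positive and already beats every payoff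
    attainable at price zero.\<close>
  have floor: "\<alpha>\<^sup>2 / \<delta> \<le> \<delta> * rival_payoff G s"
  proof -
    define k where "k = 1 - \<eta> * (G + a / real N)"
    \<comment> \<open>Both \<open>s\<close> and \<open>a\<close> lie below
      \<open>1 / (1 + \<eta>)\<close>, hence so does their average \<open>G + a / real N\<close>.
      This gives \<open>1 / (1 + \<eta>) \<le> k\<close>, and \<open>a\<close> is smaller.\<close>
    have "(1 - u) * ((1 + \<eta>) * s) + u * ((1 + \<eta>) * a) \<le> (1 - u) * 1 + u * 1"
      using u s a_small by (intro add_mono mult_left_mono) auto
    then have "(1 + \<eta>) * (G + a / real N) \<le> 1" by (simp add: Gu u_def algebra_simps)
    then have "\<eta> * ((1 + \<eta>) * (G + a / real N)) \<le> \<eta>" using eta_gt_1 by simp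
    then have "1 \<le> (1 + \<eta>) * k" by (simp add: k_def algebra_simps add_divide_distrib)
    with a_small have "(1 + \<eta>) * a < (1 + \<eta>) * k" by linarith
    then have ak: "a \<le> k" using eta_gt_1 by simp
    then have "\<delta> * a \<le> \<delta> * k" using delta_pos by (intro mult_left_mono) auto
    then have "\<alpha> \<le> \<delta> * k" using a(3) by simp
    then have "rival_payoff G a \<le> rival_payoff G s"
      using rival_payoff_max[of a] a unfolding k_def G_def s_def by simp
    moreover have "rival_payoff G a = k\<^sup>2 / 2 + k * a - a\<^sup>2 / 2" by (simp add: rival_payoff_def k_def)
    \<comment> \<open>Replacing \<open>k\<close> by the smaller \<open>a\<close> turns the three
      terms of \<open>rival_payoff G a\<close> into \<open>a\<^sup>2\<close>.\<close>
    moreover have "a\<^sup>2 \<le> k\<^sup>2" "a\<^sup>2 \<le> k * a"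
      using ak a by (auto simp: power2_eq_square intro: mult_mono)
    ultimately have "a\<^sup>2 \<le> rival_payoff G s" by linarith
    then have "\<delta> * a\<^sup>2 \<le> \<delta> * rival_payoff G s" using delta_pos by (intro mult_left_mono) auto
    moreover have "\<delta> * a\<^sup>2 = \<alpha>\<^sup>2 / \<delta>" using delta_pos by (simp add: a_def power2_eq_square)
    ultimately show ?thesis by simp
  qed
  have dev: "payoff (real N * x) (s - q n + x) \<le> payoff (real N * q n) s"
    if n: "n \<in> {1..N}" and x: "x \<in> {0..1 / real N}" and sup: "supportable (s - q n + x)" for n x
  proof -
    define y where "y = real N * x"
    have y: "0 \<le> y" "y \<le> 1" using scaled_bounds[OF x] by (auto simp: y_def)
    have Q': "s - q n + x = G + y / real N" using n N by (simp add: q_def G_def y_def)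
    have pos: "0 \<le> G + y / real N" using G y by simp
    have "payoff y (G + y / real N) \<le> payoff s s"
    proof (cases "\<alpha> \<le> \<delta> * (1 - \<eta> * (G + y / real N))")
      case True
      then have "rival_payoff G y \<le> rival_payoff G s"
        using rival_payoff_max[OF y] unfolding G_def s_def by simp
      then show ?thesis
        unfolding payoff_low_export[OF pos True] pay_s using delta_pos by (intro mult_left_mono) auto
    next
      case False
      \<comment> \<open>Total exports after the deviation average \<open>s\<close> and
        \<open>y\<close> with weights \<open>1 - u\<close> and \<open>u\<close>, so they are at most
        one, as \<open>payoff_high_export\<close> demands.\<close>
      have "G + y / real N \<le> (1 - u) * 1 + u * 1"
        unfolding Gu using u s1 y by (intro add_mono mult_left_mono) (auto simp: u_def divide_right_mono)
      then have "payoff y (G + y / real N) \<le> \<alpha>\<^sup>2 / \<delta>"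
        using False sup y pos unfolding Q' by (intro payoff_high_export) auto
      with floor pay_s show ?thesis by simp
    qed
    moreover have "real N * q n = s" using n N by (simp add: q_def)
    ultimately show ?thesis by (simp only: Q' y_def)
  qed
  have "supportable s" using s low_export by simp
  with qp dev have "reduced_nash q" unfolding reduced_nash_def qQ by blast
  then show ?thesis by (simp add: q_def s_def)
qed

section \<open>The unique equilibrium and its properties\<close>

lemma nash_equilibrium_iff:
  "nash_equilibrium w P N s \<longleftrightarrow> s = outcome_of (\<lambda>n\<in>{1..N}. symmetric_export / real N)"
  using nash_iff reduced_nash_unique reduced_nash_symmetric by metis

lemma outcome_of_symmetric:
  defines "s \<equiv> outcome_of (\<lambda>n\<in>{1..N}. symmetric_export / real N)"
  shows "qexp s = (\<lambda>n\<in>{1..N}. symmetric_export / real N)"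
    "qdom s = (\<lambda>n\<in>{1..N}. (1 - \<eta> * symmetric_export) / real N)"
    "price s CA = \<delta> * (1 - \<eta> * symmetric_export) - \<alpha>"
    "Qexp N s = symmetric_export" "Qdom N s = 1 - \<eta> * symmetric_export"
proof -
  have N: "0 < real N" using N_pos by simp
  have low: "0 \<le> symmetric_export" "\<alpha> \<le> \<delta> * (1 - \<eta> * symmetric_export)"
    using symmetric_export_bounds by auto
  have sum: "(\<Sum>n\<in>{1..N}. (\<lambda>n\<in>{1..N}. c / real N) n) = c" for c :: real
    using N by simp
  show e: "qexp s = (\<lambda>n\<in>{1..N}. symmetric_export / real N)"
    by (simp add: s_def outcome_of_def Let_def)
  show d: "qdom s = (\<lambda>n\<in>{1..N}. (1 - \<eta> * symmetric_export) / real N)"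
    unfolding s_def outcome_of_def Let_def sum using low_export(4)[OF low] by simp
  show "price s CA = \<delta> * (1 - \<eta> * symmetric_export) - \<alpha>"
    unfolding s_def outcome_of_def Let_def sum using low_export(2)[OF low] by simp
  show "Qexp N s = symmetric_export" unfolding Qexp_def e sum ..
  show "Qdom N s = 1 - \<eta> * symmetric_export" unfolding Qdom_def d sum ..
qed

text \<open>Both the comparison of quantities and the inefficiency come from
  \<open>(1 + \<eta>) * symmetric_export < 1\<close>, which puts the export cutoff strictly below
  the domestic one.\<close>

lemma nash_equilibrium_properties:
  assumes ne: "nash_equilibrium w P N s"
  shows "symmetric N s" "Qexp N s = symmetric_export" "Qdom N s = 1 - \<eta> * Qexp N s"
    "price s CA = \<delta> * (1 - \<eta> * Qexp N s) - \<alpha>" "Qexp N s < Qdom N s"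
    "\<not> conditionally_efficient w (equilibrium_allocation N s)"
proof -
  have "s = outcome_of (\<lambda>n\<in>{1..N}. symmetric_export / real N)"
    using ne by (simp only: nash_equilibrium_iff)
  note o = outcome_of_symmetric[folded this]
  show "symmetric N s" by (simp add: symmetric_def o)
  show "Qexp N s = symmetric_export" "Qdom N s = 1 - \<eta> * Qexp N s"
    "price s CA = \<delta> * (1 - \<eta> * Qexp N s) - \<alpha>" by (simp_all add: o)
  show "Qexp N s < Qdom N s" using symmetric_export_bounds by (simp add: o algebra_simps)
  define d where "d j = (case j of CA \<Rightarrow> 1 - \<eta> * symmetric_export | CB \<Rightarrow> symmetric_export)" for j
  have "0 < 1 - \<eta> * symmetric_export"
    using symmetric_export_bounds by (simp add: algebra_simps)
  moreover have "0 \<le> \<eta> * symmetric_export" using symmetric_export_bounds eta_gt_1 by simp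
  moreover have "symmetric_export < 1 - \<eta> * symmetric_export"
    using symmetric_export_bounds by (simp add: algebra_simps)
  ultimately have "\<not> conditionally_efficient w (cutoff_allocation d)"
    using symmetric_export_bounds(1)
    by (intro cutoff_allocation_inefficient) (auto simp: d_def split: country.split)
  moreover have "equilibrium_allocation N s = cutoff_allocation d"
    using N_pos by (intro equilibrium_allocation_uniform) (simp_all add: o d_def)
  ultimately show "\<not> conditionally_efficient w (equilibrium_allocation N s)" by simp
qed

end


theorem proposition9:
  fixes \<alpha>\<^sub>A \<alpha>\<^sub>B \<delta> Xbar \<eta>\<^sub>A :: real
    and w :: "country \<Rightarrow> real \<Rightarrow> real"
    and P :: policy
  assumes "0 < \<alpha>\<^sub>A" and "0 < \<alpha>\<^sub>B" and "\<delta> = \<alpha>\<^sub>A + \<alpha>\<^sub>B"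
    and "technology \<alpha>\<^sub>A \<alpha>\<^sub>B w"
    and "\<alpha>\<^sub>A \<le> \<alpha>\<^sub>B"
    and "2 * \<alpha>\<^sub>A / \<delta> < Xbar" and "Xbar < 1"
    and "tic_agreement Xbar P" and "\<eta>\<^sub>A = eta P CA"
  shows
    "(\<forall>N\<ge>1. \<exists>!s. nash_equilibrium w P N s) \<and>
     (\<forall>N\<ge>1. \<forall>s. nash_equilibrium w P N s \<longrightarrow>
        symmetric N s \<and>
        Qexp N s =
          (if real N > \<eta>\<^sub>A
           then (real N - \<eta>\<^sub>A) / (real N * (\<eta>\<^sub>A + 1) - \<eta>\<^sub>A * (\<eta>\<^sub>A - 1))
           else 0) \<and>
        price s CA = \<delta> * (1 - \<eta>\<^sub>A * Qexp N s) - \<alpha>\<^sub>A \<and>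
        Qexp N s < Qdom N s \<and>
        \<not> conditionally_efficient w (equilibrium_allocation N s)) \<and>
     (\<forall>N N' s s'. \<eta>\<^sub>A < real N \<and> N < N' \<and>
        nash_equilibrium w P N s \<and> nash_equilibrium w P N' s' \<longrightarrow>
        Qexp N s < Qexp N' s' \<and> price s' CA < price s CA) \<and>
     (\<forall>s :: nat \<Rightarrow> outcome. (\<forall>N\<ge>1. nash_equilibrium w P N (s N)) \<longrightarrow>
        (\<lambda>N. Qexp N (s N)) \<longlonglongrightarrow> 1 / (1 + \<eta>\<^sub>A) \<and>
        (\<lambda>N. Qdom N (s N)) \<longlonglongrightarrow> 1 / (1 + \<eta>\<^sub>A) \<and>
        (\<lambda>N. price (s N) CA) \<longlonglongrightarrow> \<delta> / (1 + \<eta>\<^sub>A) - \<alpha>\<^sub>A) \<and>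
     (\<forall>Qd Qe \<pi>. competitive_equilibrium w P Qd Qe \<pi> \<and> Qe > 0 \<longleftrightarrow>
        Qd = 1 / (1 + \<eta>\<^sub>A) \<and> Qe = 1 / (1 + \<eta>\<^sub>A) \<and>
        \<pi> CA = \<delta> / (1 + \<eta>\<^sub>A) - \<alpha>\<^sub>A \<and> \<pi> CB = 0)"
proof -
  have ta: "tic P CA" "\<eta>\<^sub>A = (2 - Xbar) / Xbar" "1 < \<eta>\<^sub>A" "phi P CA * eta P CA = 1"
    "tic P CB \<Longrightarrow> 1 \<le> eta P CB \<and> 0 \<le> phi P CB"
    using assms(8,9) by (auto simp: tic_agreement_def)
  have d: "0 < \<delta>" using assms by simp
  have "0 < 2 * \<alpha>\<^sub>A / \<delta>" using assms(1) d by simp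
  then have X: "0 < Xbar" using assms(6) by linarith
  have "2 * \<alpha>\<^sub>A < Xbar * \<delta>" using assms(6) d by (simp add: pos_divide_less_eq)
  \<comment> \<open>Here \<open>1 + \<eta>\<^sub>A = 2 / Xbar\<close>, so this is the assumed bound
    on the production goal.\<close>
  then have "\<alpha>\<^sub>A * (1 + \<eta>\<^sub>A) < \<delta>" unfolding ta(2) using X by (simp add: field_simps)
  then interpret tic_trade \<alpha>\<^sub>A \<alpha>\<^sub>B w P
    using assms ta by unfold_locales auto
  define f where "f N = (if real N > \<eta>\<^sub>A
           then (real N - \<eta>\<^sub>A) / (real N * (\<eta>\<^sub>A + 1) - \<eta>\<^sub>A * (\<eta>\<^sub>A - 1)) else 0)" for N
  have ex1: "\<exists>!s. nash_equilibrium w P N s" if "1 \<le> N" for N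
  proof -
    interpret tic_oligopoly \<alpha>\<^sub>A \<alpha>\<^sub>B w P N by unfold_locales (rule that)
    show ?thesis unfolding nash_equilibrium_iff by blast
  qed
  have nash_props: "symmetric N s" "Qexp N s = f N" "Qdom N s = 1 - \<eta>\<^sub>A * Qexp N s"
    "price s CA = \<delta> * (1 - \<eta>\<^sub>A * Qexp N s) - \<alpha>\<^sub>A" "Qexp N s < Qdom N s"
    "\<not> conditionally_efficient w (equilibrium_allocation N s)"
    if "1 \<le> N" "nash_equilibrium w P N s" for N s
  proof -
    interpret tic_oligopoly \<alpha>\<^sub>A \<alpha>\<^sub>B w P N by unfold_locales (rule that)
    show "symmetric N s" "Qexp N s = f N" "Qdom N s = 1 - \<eta>\<^sub>A * Qexp N s"
      "price s CA = \<delta> * (1 - \<eta>\<^sub>A * Qexp N s) - \<alpha>\<^sub>A" "Qexp N s < Qdom N s"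
      "\<not> conditionally_efficient w (equilibrium_allocation N s)"
      using nash_equilibrium_properties[OF that(2)]
      by (simp_all add: assms(3,9) symmetric_export_def f_def)
  qed
  have mono: "Qexp N s < Qexp N' s' \<and> price s' CA < price s CA"
    if "\<eta>\<^sub>A < real N" "N < N'" and ne: "nash_equilibrium w P N s" "nash_equilibrium w P N' s'" for N N' s s'
  proof -
    have N: "1 \<le> N" "1 \<le> N'" using that ta(3) by simp_all
    have "Qexp N s < Qexp N' s'"
      using export_share_strict_mono[OF ta(3) that(1), of "real N'"] that(1,2)
      unfolding nash_props(2)[OF N(1) ne(1)] nash_props(2)[OF N(2) ne(2)] f_def by simp
    moreover from this have "\<delta> * (1 - \<eta>\<^sub>A * Qexp N' s') < \<delta> * (1 - \<eta>\<^sub>A * Qexp N s)"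
      using d ta(3) by (intro mult_strict_left_mono) auto
    ultimately show ?thesis
      unfolding nash_props(4)[OF N(1) ne(1)] nash_props(4)[OF N(2) ne(2)] by simp
  qed
  have lim: "(\<lambda>N. Qexp N (s N)) \<longlonglongrightarrow> 1 / (1 + \<eta>\<^sub>A) \<and> (\<lambda>N. Qdom N (s N)) \<longlonglongrightarrow> 1 / (1 + \<eta>\<^sub>A) \<and>
      (\<lambda>N. price (s N) CA) \<longlonglongrightarrow> \<delta> / (1 + \<eta>\<^sub>A) - \<alpha>\<^sub>A"
    if s: "\<forall>N\<ge>1. nash_equilibrium w P N (s N)" for s :: "nat \<Rightarrow> outcome"
  proof -
    \<comment> \<open>The closed formula describes exports only once \<open>N\<close> exceeds
      \<open>\<eta>\<^sub>A\<close>, which suffices for the limit.\<close>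
    have "\<forall>\<^sub>F N in sequentially. (real N - \<eta>\<^sub>A) / (real N * (\<eta>\<^sub>A + 1) - \<eta>\<^sub>A * (\<eta>\<^sub>A - 1)) = Qexp N (s N)"
      using eventually_gt_at_top[of "nat \<lceil>\<eta>\<^sub>A\<rceil>"] eventually_ge_at_top[of 1]
    proof eventually_elim
      case (elim N)
      then have "\<eta>\<^sub>A < real N" by linarith
      then show ?case using nash_props(2)[of N "s N"] s elim by (simp add: f_def)
    qed
    then have E: "(\<lambda>N. Qexp N (s N)) \<longlonglongrightarrow> 1 / (1 + \<eta>\<^sub>A)"
      using export_share_tendsto[OF ta(3)] by (simp add: tendsto_cong)
    have val: "1 - \<eta>\<^sub>A * (1 / (1 + \<eta>\<^sub>A)) = 1 / (1 + \<eta>\<^sub>A)" using ta(3) by (simp add: field_simps)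
    have D: "(\<lambda>N. 1 - \<eta>\<^sub>A * Qexp N (s N)) \<longlonglongrightarrow> 1 / (1 + \<eta>\<^sub>A)"
      using E by (subst val[symmetric]) (intro tendsto_intros)
    have "(\<lambda>N. \<delta> * (1 - \<eta>\<^sub>A * Qexp N (s N)) - \<alpha>\<^sub>A) \<longlonglongrightarrow> \<delta> * (1 / (1 + \<eta>\<^sub>A)) - \<alpha>\<^sub>A"
      using D by (intro tendsto_intros)
    moreover have "\<forall>\<^sub>F N in sequentially. \<delta> * (1 - \<eta>\<^sub>A * Qexp N (s N)) - \<alpha>\<^sub>A = price (s N) CA"
      using eventually_ge_at_top[of 1] by eventually_elim (use nash_props(4) s in simp)
    ultimately have R: "(\<lambda>N. price (s N) CA) \<longlonglongrightarrow> \<delta> / (1 + \<eta>\<^sub>A) - \<alpha>\<^sub>A"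
      by (simp add: tendsto_cong)
    have "\<forall>\<^sub>F N in sequentially. 1 - \<eta>\<^sub>A * Qexp N (s N) = Qdom N (s N)"
      using eventually_ge_at_top[of 1] by eventually_elim (use nash_props(3) s in simp)
    then have "(\<lambda>N. Qdom N (s N)) \<longlonglongrightarrow> 1 / (1 + \<eta>\<^sub>A)" using D by (simp add: tendsto_cong)
    with E R show ?thesis by blast
  qed
  \<comment> \<open>This identifies the limits above with the competitive outcome: the same values
    occur in the unique competitive equilibrium with positive exports.\<close>
  have comp: "competitive_equilibrium w P Qd Qe \<pi> \<and> Qe > 0 \<longleftrightarrow>
        Qd = 1 / (1 + \<eta>\<^sub>A) \<and> Qe = 1 / (1 + \<eta>\<^sub>A) \<and>
        \<pi> CA = \<delta> / (1 + \<eta>\<^sub>A) - \<alpha>\<^sub>A \<and> \<pi> CB = 0" for Qd Qe \<pi>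
    unfolding assms(3,9) by (rule competitive_trade_iff)
  show ?thesis
    using ex1 nash_props mono lim comp unfolding f_def by blast
qed

end
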